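(* Let $k\ge3$ and $b\ge1$ be fixed integers. Then \[ \int_{[0,1]^{k-2}\times A}\big|g_k(\boldsymbol{\alpha},\theta;X)\big|^{2b}\,d\boldsymbol{\alpha}\,d\theta\ll_{b,k}(\log(4X))^{2b}\Big(\sup_{\theta\in A}\psi_k^*(\theta;X)\Big)J_{b,k}(4X+1) \] uniformly for $X\ge1$, $c\in\mathbb{R}$ and Lebesgue-measurable sets $A\subset[c,c+1]$.
   Context: $e(x)=e^{2\pi i x}$ and $\|y\|$ denotes the distance from $y\in\mathbb{R}$ to the nearest integer (with $\min(X^{k-1},1/0)$ understood as $X^{k-1}$). For $\boldsymbol{\beta}\in\mathbb{R}^m$, $P_m(\boldsymbol{\beta};t)=\sum_{i=1}^m\beta_it^i$. Define $\psi_k(\theta,\mu;X)=\frac1X\sum_{1\le y\le X}\min\big(X^{k-1},\frac{1}{\|k\theta y+\mu\|}\big)$ (sum over integers $y$), $\psi_k^*(\theta;X)=\sup_{\mu\in\mathbb{R}}\psi_k(\theta,\mu;X)$, $g_k(\boldsymbol{\alpha},\theta;X)=\sum_{x\in\mathbb{Z},|x|\le X}e\big(P_{k-2}(\boldsymbol{\alpha};x)+\theta x^k\big)$ for $(\boldsymbol{\alpha},\theta)\in\mathbb{R}^{k-2}\times\mathbb{R}$, and $J_{b,k}(Y)=\int_{[0,1]^k}\big|\sum_{x\in\mathbb{Z},1\le x\le Y}e\big(\sum_{j=1}^k\beta_jx^j\big)\big|^{2b}d\boldsymbol{\beta}$. *)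

theory Defs
  imports "HOL-Analysis.Analysis"
begin

text \<open>The additive character \<open>e(x) = exp(2 \<pi> i x)\<close>.\<close>

definition e_char :: "real \<Rightarrow> complex" where
  "e_char x = exp (2 * of_real pi * \<i> * of_real x)"

definition dist_int :: "real \<Rightarrow> real" where
  "dist_int y = \<bar>y - of_int (round y)\<bar>"

text \<open>\<open>min (M, 1 / d)\<close> for \<open>d \<ge> 0\<close>, with \<open>1 / 0\<close> read as infinity (in HOL it would be \<open>0\<close>).\<close>

definition min_recip :: "real \<Rightarrow> real \<Rightarrow> real" where
  "min_recip M d = (if d = 0 then M else min M (1 / d))"

text \<open>Vectors in \<open>\<real>\<^sup>m\<close> are functions on \<^typ>\<open>nat\<close>, of which only the values at \<open>1, \<dots>, m\<close> are used.\<close>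

definition P :: "nat \<Rightarrow> (nat \<Rightarrow> real) \<Rightarrow> real \<Rightarrow> real" where
  "P m \<beta> t = (\<Sum>i=1..m. \<beta> i * t ^ i)"

definition psi :: "nat \<Rightarrow> real \<Rightarrow> real \<Rightarrow> real \<Rightarrow> real" where
  "psi k \<theta> \<mu> X =
     1 / X * (\<Sum>y::int\<in>{1..\<lfloor>X\<rfloor>}. min_recip (X ^ (k - 1)) (dist_int (real k * \<theta> * of_int y + \<mu>)))"

text \<open>For \<open>X \<ge> 1\<close> the values of \<open>psi k \<theta> \<mu> X\<close> lie between \<open>0\<close> and \<open>X ^ (k - 1)\<close>, so this is a
  genuine supremum.\<close>

definition psi_star :: "nat \<Rightarrow> real \<Rightarrow> real \<Rightarrow> real" where
  "psi_star k \<theta> X = (SUP \<mu>. psi k \<theta> \<mu> X)"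

definition g :: "nat \<Rightarrow> (nat \<Rightarrow> real) \<Rightarrow> real \<Rightarrow> real \<Rightarrow> complex" where
  "g k \<alpha> \<theta> X =
     (\<Sum>x::int\<in>{-\<lfloor>X\<rfloor>..\<lfloor>X\<rfloor>}. e_char (P (k - 2) \<alpha> (of_int x) + \<theta> * of_int x ^ k))"

abbreviation lborel_pow :: "nat \<Rightarrow> (nat \<Rightarrow> real) measure" where
  "lborel_pow m \<equiv> Pi\<^sub>M {1..m} (\<lambda>_. lborel)"

abbreviation unit_cube :: "nat \<Rightarrow> (nat \<Rightarrow> real) set" where
  "unit_cube m \<equiv> {1..m} \<rightarrow>\<^sub>E {0..1}"

definition J :: "nat \<Rightarrow> nat \<Rightarrow> real \<Rightarrow> real" where
  "J b k Y =
     (LINT \<beta>:unit_cube k|lborel_pow k.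
        norm (\<Sum>x::int\<in>{1..\<lfloor>Y\<rfloor>}. e_char (P k \<beta> (of_int x))) ^ (2 * b))"

end

theory Submission
  imports Defs
begin

text \<open>Write \<open>x = z - w\<close> with \<open>\<lfloor>X\<rfloor> < w \<le> 2 \<lfloor>X\<rfloor>\<close>, so that \<open>z\<close> ranges over a subinterval of \<open>{1..N}\<close>,
  \<open>N = \<lfloor>4 X + 1\<rfloor>\<close>. Completing the sum over \<open>z\<close> modulo \<open>N\<close> costs a factor \<open>log N\<close> and a linear twist.
  In the \<open>2 b\<close>-th moment over \<open>\<alpha>\<close> all terms of degree at most \<open>k - 2\<close>, including the twist,
  are invisible, so that moment equals \<open>H (\<theta>, - k \<theta> w)\<close>, where \<open>H (\<theta>, \<mu>)\<close> sums
  \<open>e(\<theta> s\<^sub>k + \<mu> s\<^sub>k\<^sub>-\<^sub>1)\<close> over the pairs of \<open>b\<close>-tuples in \<open>{1..N}\<close> whose power sums of degree at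
  most \<open>k - 2\<close> agree, with \<open>s\<^sub>j\<close> the difference of the power sums of degree \<open>j\<close>. As a trigonometric
  polynomial in \<open>\<mu>\<close>, the nonnegative function \<open>H\<close> is reproduced by convolution with a Dirichlet
  kernel of degree \<open>O(X\<^sup>k\<^sup>-\<^sup>1)\<close>; averaging that kernel over \<open>w\<close> gives \<open>\<psi>\<^sub>k\<^sup>*\<close>. The remaining integrals of \<open>H\<close> over
  \<open>\<mu>\<close> and \<open>\<theta>\<close> count the solutions of the full Vinogradov system, which is \<open>J\<^sub>b\<^sub>,\<^sub>k\<close>.\<close>

subsection \<open>The additive character\<close>

lemma e_char_eq_cis: "e_char x = cis (2 * pi * x)"
  by (simp add: e_char_def cis_conv_exp mult_ac)

lemma norm_e_char [simp]: "norm (e_char x) = 1"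
  by (simp add: e_char_eq_cis)

lemma e_char_add: "e_char (x + y) = e_char x * e_char y"
  by (simp add: e_char_eq_cis cis_mult algebra_simps)

lemma e_char_minus: "e_char (- x) = cnj (e_char x)"
  by (simp add: e_char_eq_cis cis_cnj)

lemma e_char_diff: "e_char (x - y) = e_char x * cnj (e_char y)"
  using e_char_add[of x "- y"] by (simp add: e_char_minus)

lemma e_char_0 [simp]: "e_char 0 = 1"
  by (simp add: e_char_eq_cis)

lemma e_char_sum: "e_char (sum f A) = (\<Prod>i\<in>A. e_char (f i))"
  by (induction A rule: infinite_finite_induct) (simp_all add: e_char_add)

lemma e_char_of_int [simp]: "e_char (of_int h) = 1"
proof -
  have "e_char (of_int h) = cis (2 * pi * of_int h)" by (rule e_char_eq_cis)
  also have "\<dots> = 1" by (rule cis_multiple_2pi) simp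
  finally show ?thesis .
qed

lemma e_char_periodic: "e_char (x + of_int h) = e_char x"
  by (simp add: e_char_add)

lemma continuous_on_e_char [continuous_intros]:
  "continuous_on A f \<Longrightarrow> continuous_on A (\<lambda>x. e_char (f x))"
  unfolding e_char_def by (intro continuous_intros)

lemma borel_measurable_e_char [measurable]: "e_char \<in> borel_measurable borel"
  by (intro borel_measurable_continuous_onI continuous_intros)

text \<open>The antiderivative is itself 1-periodic for nonzero \<open>h\<close>, so it takes equal
  values at \<open>c\<close> and \<open>c + 1\<close>. The base point is left free because
  \<open>A\<close> is only known to lie in \<open>{c..c + 1}\<close>.\<close>

lemma
  fixes c :: real and h :: int
  shows integrable_e_char: "integrable lborel (\<lambda>t. indicator {c..c + 1} t *\<^sub>R e_char (t * of_int h))"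
    and integral_e_char: "(LINT t|lborel. indicator {c..c + 1} t *\<^sub>R e_char (t * of_int h)) = of_bool (h = 0)"
proof -
  show "integrable lborel (\<lambda>t. indicator {c..c + 1} t *\<^sub>R e_char (t * of_int h))"
    by (intro borel_integrable_compact continuous_intros) auto
  show "(LINT t|lborel. indicator {c..c + 1} t *\<^sub>R e_char (t * of_int h)) = of_bool (h = 0)"
  proof (cases "h = 0")
    case True
    then show ?thesis by (simp add: scaleR_conv_of_real)
  next
    case False
    define F where "F t = e_char (t * of_int h) / (2 * of_real pi * \<i> * of_int h)" for t
    have "(F has_vector_derivative e_char (t * of_int h)) (at t within {c..c+1})" for t
    proof -
      have "((\<lambda>z. exp (2 * of_real pi * \<i> * (z * of_int h)) / (2 * of_real pi * \<i> * of_int h))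
             has_field_derivative exp (2 * of_real pi * \<i> * (of_real t * of_int h))) (at (of_real t))"
        using False by (auto intro!: derivative_eq_intros simp: field_simps)
      from has_vector_derivative_real_field[OF this] show ?thesis
        by (simp add: F_def[abs_def] e_char_def)
    qed
    then have "(LINT t|lborel. indicator {c..c + 1} t *\<^sub>R e_char (t * of_int h)) = F (c + 1) - F c"
      by (intro integral_FTC_atLeastAtMost continuous_intros) auto
    also have "F (c + 1) = F c"
      using e_char_periodic[of "c * of_int h" h] by (simp add: F_def algebra_simps)
    finally show ?thesis using False by simp
  qed
qed

section \<open>Bounds for geometric sums of additive characters\<close>

lemma sin_ge_chord:
  assumes "0 \<le> x" "x \<le> pi / 2"
  shows "2 / pi * x \<le> sin x"
proof -
  have "concave_on {0..pi} sin"
  proof (rule f''_le0_imp_concave[where f' = cos and f'' = "\<lambda>x. - sin x"])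
    show "- sin x \<le> 0" if "x \<in> {0..pi}" for x
      using that by (auto intro: sin_ge_zero)
  qed (auto intro!: derivative_eq_intros)
  \<comment> \<open>The point \<open>x\<close> is the convex combination of \<open>0\<close> and
    \<open>pi / 2\<close> with weight \<open>2 / pi * x\<close>, so concavity places
    \<open>sin x\<close> above the chord.\<close>
  from concave_onD[OF this, of "2 / pi * x" 0 "pi / 2"] assms show ?thesis
    by (simp add: field_simps)
qed

lemma norm_e_char_minus_1: "norm (e_char x - 1) = 2 * \<bar>sin (pi * x)\<bar>"
proof -
  have "norm (e_char x - 1)^2 = (2 * \<bar>sin (pi * x)\<bar>)^2"
  proof -
    have "norm (e_char x - 1)^2 = (cos (2*(pi*x)) - 1)^2 + (sin (2*(pi*x)))^2"
      by (simp add: e_char_eq_cis cmod_power2 mult.assoc)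
    also have "\<dots> = 4 * (sin (pi*x))^2"
    proof -
      have "sin (2*(pi*x))^2 + cos (2*(pi*x))^2 = 1" by simp
      moreover have "cos (2*(pi*x)) = 1 - 2 * sin (pi*x) ^ 2" by (rule cos_double_sin)
      ultimately show ?thesis by algebra
    qed
    finally show ?thesis by (simp add: power_mult_distrib)
  qed
  then show ?thesis by (rule power2_eq_imp_eq) auto
qed

lemma dist_int_nonneg: "dist_int x \<ge> 0"
  by (simp add: dist_int_def)

lemma dist_int_le_half: "dist_int x \<le> 1 / 2"
  using of_int_round_abs_le[of x] by (simp add: dist_int_def abs_minus_commute)

text \<open>Periodicity of the character replaces \<open>x\<close> by its signed distance
  \<open>r\<close> to the nearest integer; then \<open>pi * \<bar>r\<bar>\<close> lies in the range
  of the chord bound.\<close>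

lemma abs_sin_ge_dist_int: "2 * dist_int x \<le> \<bar>sin (pi * x)\<bar>"
proof -
  define r where "r = x - of_int (round x)"
  have "\<bar>sin (pi * x)\<bar> = \<bar>sin (pi * r)\<bar>"
  proof -
    have "norm (e_char x - 1) = norm (e_char r - 1)"
      using e_char_periodic[of r "round x"] by (simp add: r_def)
    then show ?thesis by (simp add: norm_e_char_minus_1)
  qed
  also have "\<bar>sin (pi * r)\<bar> = \<bar>sin (pi * \<bar>r\<bar>)\<bar>" by (cases "r \<ge> 0") auto
  also have "\<dots> \<ge> sin (pi * \<bar>r\<bar>)" by simp
  also have "sin (pi * \<bar>r\<bar>) \<ge> 2 / pi * (pi * \<bar>r\<bar>)"
    using dist_int_le_half[of x] by (intro sin_ge_chord) (auto simp: r_def dist_int_def)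
  finally show ?thesis by (simp add: dist_int_def r_def)
qed

text \<open>Multiplication by \<open>e_char t - 1\<close> telescopes the progression to a difference
  of two unimodular numbers, while \<open>norm (e_char t - 1)\<close> is at least
  \<open>4 * dist_int t\<close>. The product form remains meaningful for integral \<open>t\<close>,
  where the distance is \<open>0\<close>.\<close>

lemma norm_sum_e_char_mult_le:
  fixes m n :: int
  assumes "m \<le> n"
  shows "norm (\<Sum>x=m..n. e_char (t * of_int x)) * dist_int t \<le> 1 / 2"
proof -
  have "(e_char t - 1) * (\<Sum>x=m..n. e_char (t * of_int x)) = e_char (t * of_int (n + 1)) - e_char (t * of_int m)"
    using assms
  proof (induction n rule: int_ge_induct)
    case base
    then show ?case by (simp add: e_char_add algebra_simps)
  next
    case (step i)
    have "{m..i + 1} = insert (i + 1) {m..i}" using step by auto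
    moreover have "e_char (t * 2) = e_char t * e_char t"
      using e_char_add[of t t] by (metis mult_2_right)
    ultimately show ?case using step by (simp add: e_char_add algebra_simps)
  qed
  then have "norm (e_char t - 1) * norm (\<Sum>x=m..n. e_char (t * of_int x)) = norm (e_char (t * of_int (n + 1)) - e_char (t * of_int m))"
    by (metis norm_mult)
  also have "\<dots> \<le> 2"
    by (rule order.trans[OF norm_triangle_ineq4]) simp
  finally have "2 * \<bar>sin (pi * t)\<bar> * norm (\<Sum>x=m..n. e_char (t * of_int x)) \<le> 2"
    by (simp add: norm_e_char_minus_1)
  moreover have "2 * dist_int t * norm (\<Sum>x=m..n. e_char (t * of_int x)) \<le> \<bar>sin (pi * t)\<bar> * norm (\<Sum>x=m..n. e_char (t * of_int x))"
    by (intro mult_right_mono abs_sin_ge_dist_int) auto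
  ultimately show ?thesis by (simp add: mult.commute)
qed

lemma norm_sum_e_char_le_card: "norm (\<Sum>x\<in>A. e_char (f x)) \<le> card A"
  by (rule order.trans[OF sum_norm_le[where g="\<lambda>_. 1"]]) auto

subsection \<open>Even moments over the unit cube\<close>

text \<open>Distributivity applied to \<open>s ^ b * cnj s ^ b\<close> gives one term for each pair
  of \<open>b\<close>-tuples.\<close>

lemma norm_sum_e_char_power:
  fixes \<phi> :: "'a \<Rightarrow> real"
  assumes "finite S"
  shows "of_real (norm (\<Sum>z\<in>S. e_char (\<phi> z)) ^ (2 * b)) =
    (\<Sum>(t, u)\<in>({..<b} \<rightarrow>\<^sub>E S) \<times> ({..<b} \<rightarrow>\<^sub>E S). e_char (\<Sum>i<b. \<phi> (t i) - \<phi> (u i)))"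
proof -
  let ?T = "{..<b} \<rightarrow>\<^sub>E S" and ?s = "\<Sum>z\<in>S. e_char (\<phi> z)"
  have "of_real (norm ?s ^ (2 * b)) = ?s ^ b * cnj ?s ^ b"
    by (metis complex_norm_square of_real_power power_mult power_mult_distrib)
  also have "?s ^ b = (\<Sum>t\<in>?T. \<Prod>i<b. e_char (\<phi> (t i)))"
    using prod_sum_PiE[of "{..<b}" "\<lambda>_. S" "\<lambda>_ z. e_char (\<phi> z)"] assms by simp
  also have "cnj ?s ^ b = (\<Sum>u\<in>?T. \<Prod>i<b. cnj (e_char (\<phi> (u i))))"
    using prod_sum_PiE[of "{..<b}" "\<lambda>_. S" "\<lambda>_ z. cnj (e_char (\<phi> z))"] assms by simp
  also have "(\<Sum>t\<in>?T. \<Prod>i<b. e_char (\<phi> (t i))) * (\<Sum>u\<in>?T. \<Prod>i<b. cnj (e_char (\<phi> (u i))))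
      = (\<Sum>(t, u)\<in>?T \<times> ?T. e_char (\<Sum>i<b. \<phi> (t i) - \<phi> (u i)))"
    by (simp add: sum_product sum.cartesian_product e_char_sum e_char_diff prod.distrib)
  finally show ?thesis .
qed

text \<open>The integrand is a product of functions of single coordinates, so Fubini reduces the
  claim to orthogonality on \<open>{0..1}\<close>.\<close>

lemma
  fixes h :: "nat \<Rightarrow> int"
  shows integrable_cube_e_char: "integrable (lborel_pow m)
      (\<lambda>\<alpha>. indicator (unit_cube m) \<alpha> *\<^sub>R e_char (\<Sum>j=1..m. \<alpha> j * of_int (h j)))"
    and integral_cube_e_char: "(LINT \<alpha>|lborel_pow m.
      indicator (unit_cube m) \<alpha> *\<^sub>R e_char (\<Sum>j=1..m. \<alpha> j * of_int (h j)))
      = of_bool (\<forall>j\<in>{1..m}. h j = 0)"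
proof -
  interpret product_sigma_finite "\<lambda>_. lborel :: real measure"
    by unfold_locales
  let ?f = "\<lambda>j t. indicator {0..1} t *\<^sub>R e_char (t * of_int (h j))"
  have int: "integrable lborel (?f j)" for j
    using integrable_e_char[of 0 "h j"] by simp
  have eq: "indicator (unit_cube m) \<alpha> *\<^sub>R e_char (\<Sum>j=1..m. \<alpha> j * of_int (h j)) = (\<Prod>j\<in>{1..m}. ?f j (\<alpha> j))"
    if "\<alpha> \<in> space (lborel_pow m)" for \<alpha>
  proof (cases "\<alpha> \<in> unit_cube m")
    case True
    then have "?f j (\<alpha> j) = e_char (\<alpha> j * of_int (h j))" if "j \<in> {1..m}" for j
      using PiE_mem[OF True that] by simp
    with True show ?thesis by (simp add: e_char_sum)
  next
    case False
    \<comment> \<open>Points of the product space are extensional, so they can leave the cube only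
      through a coordinate in \<open>{1..m}\<close>.\<close>
    with that obtain j where "j \<in> {1..m}" "\<alpha> j \<notin> {0..1}"
      by (auto simp: space_PiM PiE_def Pi_def)
    then have "(\<Prod>j\<in>{1..m}. ?f j (\<alpha> j)) = 0"
      by (intro prod_zero) (auto intro!: bexI[of _ j])
    with False show ?thesis by simp
  qed
  show "integrable (lborel_pow m)
      (\<lambda>\<alpha>. indicator (unit_cube m) \<alpha> *\<^sub>R e_char (\<Sum>j=1..m. \<alpha> j * of_int (h j)))"
    using product_integrable_prod[of "{1..m}" ?f] int
    by (subst Bochner_Integration.integrable_cong[OF refl eq]) auto
  have "(LINT \<alpha>|lborel_pow m. indicator (unit_cube m) \<alpha> *\<^sub>R e_char (\<Sum>j=1..m. \<alpha> j * of_int (h j)))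
      = (LINT \<alpha>|lborel_pow m. (\<Prod>j\<in>{1..m}. ?f j (\<alpha> j)))"
    by (rule Bochner_Integration.integral_cong[OF refl eq])
  also have "\<dots> = (\<Prod>j\<in>{1..m}. of_bool (h j = 0))"
    using product_integral_prod[of "{1..m}" ?f] int integral_e_char[of 0] by simp
  also have "\<dots> = of_bool (\<forall>j\<in>{1..m}. h j = 0)"
    by (auto simp: prod_zero_iff)
  finally show "(LINT \<alpha>|lborel_pow m.
      indicator (unit_cube m) \<alpha> *\<^sub>R e_char (\<Sum>j=1..m. \<alpha> j * of_int (h j)))
      = of_bool (\<forall>j\<in>{1..m}. h j = 0)" .
qed

section \<open>Vinogradov's system and its translation invariance\<close>

definition power_diff :: "nat \<Rightarrow> nat \<Rightarrow> (nat \<Rightarrow> int) \<Rightarrow> (nat \<Rightarrow> int) \<Rightarrow> int" where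
  "power_diff b j t u = (\<Sum>i<b. t i ^ j - u i ^ j)"

text \<open>Vinogradov's system of degrees 1 to \<open>m\<close> with \<open>b\<close> variables on
  each side. Extensionality makes each tuple correspond to exactly one function, so that
  cardinalities are solution counts.\<close>

definition solutions :: "nat \<Rightarrow> int set \<Rightarrow> nat \<Rightarrow> ((nat \<Rightarrow> int) \<times> (nat \<Rightarrow> int)) set" where
  "solutions b S m = {(t, u) \<in> ({..<b} \<rightarrow>\<^sub>E S) \<times> ({..<b} \<rightarrow>\<^sub>E S). \<forall>j\<in>{1..m}. power_diff b j t u = 0}"

lemma finite_solutions: "finite S \<Longrightarrow> finite (solutions b S m)"
  unfolding solutions_def
  by (rule finite_subset[of _ "({..<b} \<rightarrow>\<^sub>E S) \<times> ({..<b} \<rightarrow>\<^sub>E S)"]) (auto intro!: finite_PiE)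

text \<open>By the binomial theorem a translation acts on the differences of power sums through a
  triangular matrix with unit diagonal.\<close>

lemma power_diff_shift:
  "power_diff b j (\<lambda>i. t i - w) (\<lambda>i. u i - w) =
     (\<Sum>l\<le>j. of_nat (j choose l) * (- w) ^ (j - l) * power_diff b l t u)"
proof -
  have "(x - w) ^ j = (\<Sum>l\<le>j. of_nat (j choose l) * (- w) ^ (j - l) * x ^ l)" for x
    using binomial_ring[of x "- w" j] by (simp add: mult_ac)
  then have "power_diff b j (\<lambda>i. t i - w) (\<lambda>i. u i - w) =
     (\<Sum>i<b. \<Sum>l\<le>j. of_nat (j choose l) * (- w) ^ (j - l) * (t i ^ l - u i ^ l))"
    by (simp add: power_diff_def right_diff_distrib sum_subtractf)
  also have "\<dots> = (\<Sum>l\<le>j. of_nat (j choose l) * (- w) ^ (j - l) * power_diff b l t u)"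
    by (subst sum.swap) (simp add: power_diff_def sum_distrib_left)
  finally show ?thesis .
qed

lemma power_diff_0 [simp]: "power_diff b 0 t u = 0"
  by (simp add: power_diff_def)

lemma power_diff_shift_eq_0:
  assumes "\<forall>j\<in>{1..m}. power_diff b j t u = 0" "j \<le> m"
  shows "power_diff b j (\<lambda>i. t i - w) (\<lambda>i. u i - w) = 0"
proof -
  have "power_diff b l t u = 0" if "l \<le> j" for l
    using assms that by (cases "l = 0") auto
  then show ?thesis by (simp add: power_diff_shift)
qed

lemma power_diff_shift_eq_0_iff:
  "(\<forall>j\<in>{1..m}. power_diff b j (\<lambda>i. t i - w) (\<lambda>i. u i - w) = 0) \<longleftrightarrow>
   (\<forall>j\<in>{1..m}. power_diff b j t u = 0)"
  \<comment> \<open>The converse direction is the same implication for the shifted tuples,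
    translated back by \<open>- w\<close>.\<close>
  using power_diff_shift_eq_0[of m b t u _ w]
    power_diff_shift_eq_0[of m b "\<lambda>i. t i - w" "\<lambda>i. u i - w" _ "- w"]
  by auto

text \<open>Only the terms of degree \<open>k\<close> and \<open>k - 1\<close> survive in the
  binomial expansion. The second of them is the source of the argument \<open>- k \<theta> w\<close>
  of \<open>restricted_sum\<close> below.\<close>

lemma power_diff_shift_top:
  assumes "\<forall>j\<in>{1..k-2}. power_diff b j t u = 0" "k \<ge> 2"
  shows "power_diff b k (\<lambda>i. t i - w) (\<lambda>i. u i - w) =
    power_diff b k t u - of_nat k * w * power_diff b (k - 1) t u"
proof -
  obtain m where k: "k = Suc (Suc m)" using assms(2) by (metis add_2_eq_Suc le_Suc_ex)
  have z: "power_diff b l t u = 0" if "l \<le> m" for l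
    using assms that k by (cases "l = 0") auto
  show ?thesis
    \<comment> \<open>Symmetry of the binomial coefficients evaluates
      \<open>k choose (k - 1)\<close> as \<open>k\<close>.\<close>
    by (simp add: power_diff_shift k z binomial_symmetric[of "Suc m" "Suc (Suc m)"])
qed

text \<open>After the even power is expanded, the coefficient of \<open>\<alpha> j\<close> in the
  phase is an integer, namely the difference of the \<open>j\<close>-th power sums of the shifted
  tuples. Orthogonality keeps the pairs for which all of these vanish, and the part
  \<open>\<phi>\<close> of the phase, being independent of \<open>\<alpha>\<close>, is carried
  along.\<close>

lemma
  fixes \<phi> :: "int \<Rightarrow> real" and b m :: nat and w :: int
  assumes "finite S"
  defines "F \<equiv> \<lambda>\<alpha>. norm (\<Sum>z\<in>S. e_char (P m \<alpha> (of_int (z - w)) + \<phi> z)) ^ (2 * b)"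
  shows set_integrable_mean_value: "set_integrable (lborel_pow m) (unit_cube m) F"
    and mean_value_eq_sum_solutions: "of_real (LINT \<alpha>:unit_cube m|lborel_pow m. F \<alpha>)
      = (\<Sum>(t, u)\<in>solutions b S m. e_char (\<Sum>i<b. \<phi> (t i) - \<phi> (u i)))"
proof -
  let ?T = "{..<b} \<rightarrow>\<^sub>E S"
  let ?c = "\<lambda>t u. e_char (\<Sum>i<b. \<phi> (t i) - \<phi> (u i))"
  let ?p = "\<lambda>t u j. power_diff b j (\<lambda>i. t i - w) (\<lambda>i. u i - w)"
  let ?I = "\<lambda>t u \<alpha>. indicator (unit_cube m) \<alpha> *\<^sub>R e_char (\<Sum>j=1..m. \<alpha> j * of_int (?p t u j))"
  have fin: "finite (?T \<times> ?T)" using assms by (auto intro!: finite_PiE)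
  have phase: "(\<Sum>i<b. (P m \<alpha> (of_int (t i - w)) + \<phi> (t i)) - (P m \<alpha> (of_int (u i - w)) + \<phi> (u i)))
      = (\<Sum>j=1..m. \<alpha> j * of_int (?p t u j)) + (\<Sum>i<b. \<phi> (t i) - \<phi> (u i))" for \<alpha> t u
  proof -
    have "(\<Sum>i<b. P m \<alpha> (of_int (t i - w)) - P m \<alpha> (of_int (u i - w))) =
       (\<Sum>i<b. \<Sum>j=1..m. \<alpha> j * (of_int ((t i - w) ^ j - (u i - w) ^ j)))"
      unfolding P_def sum_subtractf[symmetric] by (simp add: right_diff_distrib)
    also have "\<dots> = (\<Sum>j=1..m. \<alpha> j * of_int (?p t u j))"
      by (subst sum.swap) (simp add: power_diff_def sum_distrib_left)
    finally show ?thesis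
      by (simp only: add_diff_add sum.distrib)
  qed
  have expand: "of_real (indicator (unit_cube m) \<alpha> *\<^sub>R F \<alpha>) = (\<Sum>(t, u)\<in>?T \<times> ?T. ?I t u \<alpha> * ?c t u)" for \<alpha>
  proof -
    have "of_real (F \<alpha>) = (\<Sum>(t, u)\<in>?T \<times> ?T. e_char (\<Sum>j=1..m. \<alpha> j * of_int (?p t u j)) * ?c t u)"
      unfolding F_def norm_sum_e_char_power[OF assms(1)] phase by (simp only: e_char_add)
    then show ?thesis
      by (simp add: scaleR_conv_of_real sum_distrib_left case_prod_unfold mult.assoc)
  qed
  have int: "integrable (lborel_pow m) (\<lambda>\<alpha>. \<Sum>(t, u)\<in>?T \<times> ?T. ?I t u \<alpha> * ?c t u)"
    unfolding case_prod_unfold by (intro Bochner_Integration.integrable_sum integrable_mult_left integrable_cube_e_char)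
  then have intc: "integrable (lborel_pow m) (\<lambda>\<alpha>. complex_of_real (indicator (unit_cube m) \<alpha> *\<^sub>R F \<alpha>))"
    by (simp only: expand)
  then show "set_integrable (lborel_pow m) (unit_cube m) F"
    unfolding set_integrable_def using integrable_Re[OF intc] by simp
  have "complex_of_real (LINT \<alpha>:unit_cube m|lborel_pow m. F \<alpha>)
      = (LINT \<alpha>|lborel_pow m. complex_of_real (indicator (unit_cube m) \<alpha> *\<^sub>R F \<alpha>))"
    unfolding set_lebesgue_integral_def by (rule integral_complex_of_real[symmetric])
  also have "\<dots> = (LINT \<alpha>|lborel_pow m. (\<Sum>(t, u)\<in>?T \<times> ?T. ?I t u \<alpha> * ?c t u))"
    by (simp only: expand)
  also have "\<dots> = (\<Sum>(t, u)\<in>?T \<times> ?T. (LINT \<alpha>|lborel_pow m. ?I t u \<alpha>) * ?c t u)"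
    by (simp only: case_prod_unfold Bochner_Integration.integral_sum integrable_mult_left
        integral_mult_left_zero integrable_cube_e_char)
  \<comment> \<open>Translation invariance removes \<open>w\<close> from the conditions here, so
    every shift leads to the same solution set.\<close>
  also have "\<dots> = (\<Sum>(t, u)\<in>?T \<times> ?T. of_bool (\<forall>j\<in>{1..m}. power_diff b j t u = 0) * ?c t u)"
    by (simp only: integral_cube_e_char power_diff_shift_eq_0_iff)
  also have "\<dots> = (\<Sum>(t, u)\<in>solutions b S m. ?c t u)"
  proof (intro sum.mono_neutral_cong_right fin ballI)
    show "solutions b S m \<subseteq> ?T \<times> ?T" unfolding solutions_def by blast
  next
    fix p assume p: "p \<in> ?T \<times> ?T - solutions b S m"
    obtain t u where tu: "p = (t, u)" by (cases p)
    have "\<not> (\<forall>j\<in>{1..m}. power_diff b j t u = 0)"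
      using p unfolding tu solutions_def by blast
    then show "(case p of (t, u) \<Rightarrow> of_bool (\<forall>j\<in>{1..m}. power_diff b j t u = 0) * ?c t u) = 0"
      unfolding tu split_conv by (simp only: of_bool_eq mult_zero_left if_False simp_thms)
  next
    fix p assume p: "p \<in> solutions b S m"
    obtain t u where tu: "p = (t, u)" by (cases p)
    have "\<forall>j\<in>{1..m}. power_diff b j t u = 0"
      using p unfolding tu solutions_def by blast
    then show "(case p of (t, u) \<Rightarrow> of_bool (\<forall>j\<in>{1..m}. power_diff b j t u = 0) * ?c t u) =
        (case p of (t, u) \<Rightarrow> ?c t u)"
      unfolding tu split_conv by (subst of_bool_eq_1_iff[THEN iffD2]) (assumption, rule mult_1_left)
  qed
  finally show "of_real (LINT \<alpha>:unit_cube m|lborel_pow m. F \<alpha>) = (\<Sum>(t, u)\<in>solutions b S m. ?c t u)" .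
qed

subsection \<open>Completion of incomplete sums\<close>

lemma e_char_eq_1D:
  assumes "e_char x = 1" shows "x = of_int (round x)"
proof -
  have "sin (pi * x) = 0" using norm_e_char_minus_1[of x] assms by simp
  then have "dist_int x \<le> 0" using abs_sin_ge_dist_int[of x] by simp
  then show ?thesis by (simp add: dist_int_def)
qed

lemma e_char_power: "e_char x ^ n = e_char (real n * x)"
  by (induction n) (simp_all add: e_char_add distrib_right)

text \<open>Either all terms are 1, or the ratio is an \<open>N\<close>-th root of unity different
  from 1 and the geometric sum vanishes.\<close>

lemma sum_e_char_residues:
  fixes N :: nat and z :: int
  assumes "N > 0"
  shows "(\<Sum>r<N. e_char (real r * (of_int z / real N))) = of_nat N * of_bool (int N dvd z)"
proof -
  let ?q = "e_char (of_int z / real N)"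
  have sum: "(\<Sum>r<N. e_char (real r * (of_int z / real N))) = (\<Sum>r<N. ?q ^ r)"
    by (simp add: e_char_power)
  have qN: "?q ^ N = 1" using assms by (simp add: e_char_power)
  show ?thesis
  proof (cases "int N dvd z")
    case True
    then obtain d where "z = int N * d" by blast
    then have "of_int z / real N = of_int d" using assms by simp
    then have "?q = 1" by simp
    then show ?thesis using True unfolding sum by simp
  next
    case False
    have "?q \<noteq> 1"
    proof
      assume "?q = 1"
      then have "of_int z / real N = of_int (round (of_int z / real N))" by (rule e_char_eq_1D)
      then have "of_int z = real N * of_int (round (of_int z / real N))"
        using assms by (simp add: field_simps)
      then have "z = int N * round (of_int z / real N)"
        by (metis of_int_eq_iff of_int_mult of_int_of_nat_eq)
      with False show False by (metis dvd_triv_left)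
    qed
    then show ?thesis using False qN unfolding sum by (simp add: geometric_sum)
  qed
qed

text \<open>The absolute value of the \<open>r\<close>-th normalised Fourier coefficient modulo
  \<open>N\<close> of the indicator function of \<open>{m..n}\<close>.\<close>

definition completion_weight :: "nat \<Rightarrow> int \<Rightarrow> int \<Rightarrow> nat \<Rightarrow> real" where
  "completion_weight N m n r = norm (\<Sum>x=m..n. e_char (- (real r / real N) * of_int x)) / real N"

text \<open>The indicator of \<open>{m..n}\<close> is expanded in characters modulo
  \<open>N\<close>; interchanging the sums leaves twisted complete sums over
  \<open>{1..int N}\<close>, and the triangle inequality finishes.\<close>

lemma norm_incomplete_sum_le:
  fixes a :: "int \<Rightarrow> complex" and N :: nat
  assumes "1 \<le> m" "n \<le> int N" "N > 0"
  shows "norm (\<Sum>x=m..n. a x) \<le>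
    (\<Sum>r<N. completion_weight N m n r * norm (\<Sum>z=1..int N. a z * e_char (real r / real N * of_int z)))"
proof -
  have detect: "(\<Sum>x=m..n. \<Sum>r<N. e_char (real r * (of_int (z - x) / real N))) = of_nat N * of_bool (z \<in> {m..n})"
    if z: "z \<in> {1..int N}" for z
  proof -
    \<comment> \<open>Both numbers lie in \<open>{1..int N}\<close>, so congruence modulo
      \<open>N\<close> forces equality.\<close>
    have dvd: "int N dvd z - x \<longleftrightarrow> z = x" if "x \<in> {m..n}" for x
    proof -
      have "\<bar>z - x\<bar> < int N" using z that assms by auto
      then show ?thesis using zdvd_imp_le[of "int N" "\<bar>z - x\<bar>"] by auto
    qed
    have "(\<Sum>x=m..n. \<Sum>r<N. e_char (real r * (of_int (z - x) / real N)))
       = (\<Sum>x=m..n. if z = x then of_nat N else 0)"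
      by (intro sum.cong refl, subst sum_e_char_residues) (auto simp: dvd assms)
    then show ?thesis by simp
  qed
  have "of_nat N * (\<Sum>x=m..n. a x) = (\<Sum>z=1..int N. a z * (of_nat N * of_bool (z \<in> {m..n})))"
  proof -
    have "(\<Sum>z=1..int N. a z * (of_nat N * of_bool (z \<in> {m..n}))) = (\<Sum>z=m..n. a z * of_nat N)"
      using assms by (intro sum.mono_neutral_cong_right) auto
    then show ?thesis by (simp add: sum_distrib_left mult.commute)
  qed
  also have "\<dots> = (\<Sum>z=1..int N. a z * (\<Sum>x=m..n. \<Sum>r<N. e_char (real r * (of_int (z - x) / real N))))"
    by (intro sum.cong refl) (simp only: detect)
  also have "\<dots> = (\<Sum>r<N. \<Sum>x=m..n. \<Sum>z=1..int N. a z * e_char (real r * (of_int (z - x) / real N)))"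
  proof -
    have "(\<Sum>z=1..int N. a z * (\<Sum>x=m..n. \<Sum>r<N. e_char (real r * (of_int (z - x) / real N))))
       = (\<Sum>z=1..int N. \<Sum>r<N. \<Sum>x=m..n. a z * e_char (real r * (of_int (z - x) / real N)))"
      by (subst sum.swap[of _ "{m..n}"]) (simp add: sum_distrib_left)
    also have "\<dots> = (\<Sum>r<N. \<Sum>z=1..int N. \<Sum>x=m..n. a z * e_char (real r * (of_int (z - x) / real N)))"
      by (rule sum.swap)
    also have "\<dots> = (\<Sum>r<N. \<Sum>x=m..n. \<Sum>z=1..int N. a z * e_char (real r * (of_int (z - x) / real N)))"
      by (intro sum.cong refl sum.swap)
    finally show ?thesis .
  qed
  also have "\<dots> = (\<Sum>r<N. (\<Sum>x=m..n. e_char (- (real r / real N) * of_int x)) *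
      (\<Sum>z=1..int N. a z * e_char (real r / real N * of_int z)))"
  proof (intro sum.cong refl)
    fix r
    have "e_char (real r * (of_int (z - x) / real N)) =
      e_char (- (real r / real N) * of_int x) * e_char (real r / real N * of_int z)" for x z
      by (simp add: e_char_add[symmetric] diff_divide_distrib right_diff_distrib)
    then show "(\<Sum>x=m..n. \<Sum>z=1..int N. a z * e_char (real r * (of_int (z - x) / real N))) =
      (\<Sum>x=m..n. e_char (- (real r / real N) * of_int x)) * (\<Sum>z=1..int N. a z * e_char (real r / real N * of_int z))"
      by (simp only: sum_product mult_ac)
  qed
  finally have eq: "of_nat N * (\<Sum>x=m..n. a x) = (\<Sum>r<N. (\<Sum>x=m..n. e_char (- (real r / real N) * of_int x)) *
      (\<Sum>z=1..int N. a z * e_char (real r / real N * of_int z)))" .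
  have "real N * norm (\<Sum>x=m..n. a x) = norm (of_nat N * (\<Sum>x=m..n. a x))"
    by (simp only: norm_mult norm_of_nat)
  also have "\<dots> \<le> (\<Sum>r<N. norm ((\<Sum>x=m..n. e_char (- (real r / real N) * of_int x)) *
      (\<Sum>z=1..int N. a z * e_char (real r / real N * of_int z))))"
    unfolding eq by (rule norm_sum)
  finally have "real N * norm (\<Sum>x=m..n. a x) \<le> (\<Sum>r<N. norm ((\<Sum>x=m..n. e_char (- (real r / real N) * of_int x)) *
      (\<Sum>z=1..int N. a z * e_char (real r / real N * of_int z))))" .
  then have "norm (\<Sum>x=m..n. a x) \<le> (\<Sum>r<N. norm ((\<Sum>x=m..n. e_char (- (real r / real N) * of_int x)) *
      (\<Sum>z=1..int N. a z * e_char (real r / real N * of_int z)))) / real N"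
    using assms by (simp add: field_simps)
  then show ?thesis
    by (simp add: completion_weight_def norm_mult sum_divide_distrib)
qed

text \<open>The distance is one of \<open>x\<close> and \<open>1 - x\<close>. Adding both
  reciprocals avoids a split at \<open>1 / 2\<close> when the bound is summed over residues.\<close>

lemma recip_dist_int_le:
  assumes "0 < x" "x < 1"
  shows "dist_int x > 0" and "1 / dist_int x \<le> 1 / x + 1 / (1 - x)"
proof -
  have r: "round x = 0 \<or> round x = 1"
    using of_int_round_abs_le[of x] assms by linarith
  then have "dist_int x = x \<or> dist_int x = 1 - x"
    using assms by (auto simp: dist_int_def)
  then show "dist_int x > 0" "1 / dist_int x \<le> 1 / x + 1 / (1 - x)"
    using assms by auto
qed

lemma completion_weight_nonneg: "completion_weight N m n r \<ge> 0"
  by (simp add: completion_weight_def)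

text \<open>The residue 0 has weight at most 1; the others are bounded by the geometric sum
  estimate, which produces a harmonic sum.\<close>

lemma sum_completion_weight_le:
  assumes "1 \<le> m" "n \<le> int N" "m \<le> n" "N > 0"
  shows "(\<Sum>r<N. completion_weight N m n r) \<le> 2 + ln (real N)"
proof -
  let ?w = "completion_weight N m n"
  have w0: "?w 0 \<le> 1"
    using assms norm_sum_e_char_le_card[of "\<lambda>x. - (real 0 / real N) * of_int x" "{m..n}"]
    by (simp add: completion_weight_def del: sum_constant)
  have wr: "?w r \<le> 1 / 2 * (1 / real r + 1 / (real (N - r)))" if "r \<in> {1..<N}" for r
  proof -
    define x where "x = real r / real N"
    have x: "0 < x" "x < 1" using that by (auto simp: x_def)
    have "norm (\<Sum>y=m..n. e_char (- x * of_int y)) = norm (\<Sum>y=m..n. e_char (x * of_int y))"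
      using complex_mod_cnj[of "\<Sum>y=m..n. e_char (x * of_int y)"] by (simp add: e_char_minus)
    then have "?w r = norm (\<Sum>y=m..n. e_char (x * of_int y)) / real N"
      by (simp add: completion_weight_def x_def)
    also have "norm (\<Sum>y=m..n. e_char (x * of_int y)) \<le> 1 / 2 * (1 / dist_int x)"
      using norm_sum_e_char_mult_le[OF assms(3), of x] recip_dist_int_le(1)[OF x] by (simp add: field_simps)
    also have "\<dots> \<le> 1 / 2 * (1 / x + 1 / (1 - x))"
      using recip_dist_int_le(2)[OF x] by simp
    also have "\<dots> / real N = 1 / 2 * (1 / real r + 1 / (real (N - r)))"
      using that by (simp add: x_def field_simps of_nat_diff)
    finally show ?thesis using assms by (simp add: divide_right_mono)
  qed
  have harm: "(\<Sum>r=1..<N. 1 / real r) \<le> 1 + ln (real N)"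
  proof -
    have "(\<Sum>r=1..<N. 1 / real r) \<le> harm N"
      unfolding harm_def by (simp add: inverse_eq_divide) (intro sum_mono2, auto)
    also have "\<dots> \<le> 1 + ln (real N)"
      \<comment> \<open>The sequence \<open>harm n - ln n\<close> decreases from its value 1 at
        \<open>n = 1\<close>.\<close>
      using euler_mascheroni_sequence_decreasing[of 1 N] assms by (simp add: harm_def)
    finally show ?thesis .
  qed
  \<comment> \<open>The reflection \<open>r \<mapsto> N - r\<close> identifies the two halves, and
    the factor \<open>1 / 2\<close> turns their sum into a single harmonic sum.\<close>
  have refl_sum: "(\<Sum>r=1..<N. 1 / real (N - r)) = (\<Sum>r=1..<N. 1 / real r)"
    by (rule sum.reindex_bij_witness[of _ "\<lambda>r. N - r" "\<lambda>r. N - r"]) auto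
  have "{..<N} = insert 0 {1..<N}" using assms by auto
  then have "(\<Sum>r<N. ?w r) = ?w 0 + (\<Sum>r=1..<N. ?w r)" by simp
  also have "\<dots> \<le> 1 + (\<Sum>r=1..<N. 1 / 2 * (1 / real r + 1 / (real (N - r))))"
    by (intro add_mono w0 sum_mono wr)
  also have "(\<Sum>r=1..<N. 1 / 2 * (1 / real r + 1 / (real (N - r)))) = (\<Sum>r=1..<N. 1 / real r)"
    by (simp only: sum_distrib_left[symmetric] sum.distrib refl_sum) simp
  finally show ?thesis using harm by linarith
qed

text \<open>Jensen's inequality for the convex function \<open>x ^ p\<close> with the normalised
  weights \<open>c i / sum c A\<close>; if the total weight is 0, both sides vanish.\<close>

lemma power_weighted_sum_le:
  fixes c x :: "'a \<Rightarrow> real"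
  assumes "finite A" "\<And>i. i \<in> A \<Longrightarrow> c i \<ge> 0" "even p" "p > 0"
  shows "(\<Sum>i\<in>A. c i * x i) ^ p \<le> sum c A ^ (p - 1) * (\<Sum>i\<in>A. c i * x i ^ p)"
proof (cases "sum c A = 0")
  case True
  then have "\<forall>i\<in>A. c i = 0" using assms by (simp add: sum_nonneg_eq_0_iff)
  then show ?thesis using assms by (simp add: zero_power)
next
  case False
  then have L: "sum c A > 0" using sum_nonneg[of A c] assms by simp
  then have "A \<noteq> {}" by auto
  have "(\<Sum>i\<in>A. (c i / sum c A) *\<^sub>R x i) ^ p \<le> (\<Sum>i\<in>A. c i / sum c A * x i ^ p)"
    using assms L \<open>A \<noteq> {}\<close>
    by (intro convex_on_sum[OF _ _ convex_power_even]) (auto simp: sum_divide_distrib[symmetric])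
  then have "((\<Sum>i\<in>A. c i * x i) / sum c A) ^ p \<le> (\<Sum>i\<in>A. c i * x i ^ p) / sum c A"
    by (simp add: sum_divide_distrib)
  then have "(\<Sum>i\<in>A. c i * x i) ^ p \<le> sum c A ^ p * ((\<Sum>i\<in>A. c i * x i ^ p) / sum c A)"
    using L by (simp add: power_divide field_simps)
  also have "\<dots> = sum c A ^ (p - 1) * (\<Sum>i\<in>A. c i * x i ^ p)"
    using L assms by (cases p) auto
  finally show ?thesis .
qed

subsection \<open>The shift argument\<close>

text \<open>The function \<open>H\<close> of the overview. It is complex valued by definition and is
  shown to be real and nonnegative next.\<close>

definition restricted_sum :: "nat \<Rightarrow> int set \<Rightarrow> nat \<Rightarrow> real \<Rightarrow> real \<Rightarrow> complex" where
  "restricted_sum b S k \<theta> \<mu> = (\<Sum>(t, u)\<in>solutions b S (k - 2).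
     e_char (\<theta> * of_int (power_diff b k t u)) * e_char (\<mu> * of_int (power_diff b (k - 1) t u)))"

lemma sum_power_phase:
  "(\<Sum>i<b. a * of_int (t i) ^ j - a * of_int (u i) ^ j) = a * of_int (power_diff b j t u)"
  by (simp add: power_diff_def sum_distrib_left right_diff_distrib)

text \<open>It is a mean value: the \<open>2 * b\<close>-th moment over the lower coefficients of an
  exponential sum with fixed coefficients \<open>\<theta>\<close> in degree \<open>k\<close> and
  \<open>\<mu>\<close> in degree \<open>k - 1\<close>.\<close>

lemma restricted_sum_nonneg:
  assumes "finite S"
  shows "restricted_sum b S k \<theta> \<mu> = of_real (norm (restricted_sum b S k \<theta> \<mu>))"
proof -
  have "(\<Sum>i<b. (\<theta> * of_int (t i) ^ k + \<mu> * of_int (t i) ^ (k - 1)) - (\<theta> * of_int (u i) ^ k + \<mu> * of_int (u i) ^ (k - 1)))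
      = \<theta> * of_int (power_diff b k t u) + \<mu> * of_int (power_diff b (k - 1) t u)" for t u
    using sum_power_phase[of \<theta> t k u b] sum_power_phase[of \<mu> t "k - 1" u b]
    by (simp add: sum.distrib sum_subtractf)
  then have "restricted_sum b S k \<theta> \<mu> = of_real (LINT \<alpha>:unit_cube (k - 2)|lborel_pow (k - 2).
      norm (\<Sum>z\<in>S. e_char (P (k - 2) \<alpha> (of_int (z - 0)) + (\<theta> * of_int z ^ k + \<mu> * of_int z ^ (k - 1)))) ^ (2 * b))"
    using mean_value_eq_sum_solutions[OF assms, of "k - 2" 0 "\<lambda>z. \<theta> * of_int z ^ k + \<mu> * of_int z ^ (k - 1)" b]
    by (simp add: restricted_sum_def e_char_add)
  moreover have "(LINT \<alpha>:unit_cube (k - 2)|lborel_pow (k - 2).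
      norm (\<Sum>z\<in>S. e_char (P (k - 2) \<alpha> (of_int (z - 0)) + (\<theta> * of_int z ^ k + \<mu> * of_int z ^ (k - 1)))) ^ (2 * b)) \<ge> 0"
    unfolding set_lebesgue_integral_def by (rule Bochner_Integration.integral_nonneg) simp
  ultimately show ?thesis by simp
qed

text \<open>On the solution set the twist by \<open>\<gamma>\<close> contributes a multiple of the
  difference of first power sums, which is 0, and the shifted \<open>k\<close>-th powers contribute
  the two terms of \<open>power_diff_shift_top\<close>.\<close>

lemma mean_value_shift:
  assumes "finite S" "k \<ge> 3"
  shows "(LINT \<alpha>:unit_cube (k - 2)|lborel_pow (k - 2).
      norm (\<Sum>z\<in>S. e_char (P (k - 2) \<alpha> (of_int (z - w)) + (\<theta> * of_int (z - w) ^ k + \<gamma> * of_int z))) ^ (2 * b))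
    = norm (restricted_sum b S k \<theta> (- (real k * \<theta> * of_int w)))"
proof -
  have "of_real (LINT \<alpha>:unit_cube (k - 2)|lborel_pow (k - 2).
      norm (\<Sum>z\<in>S. e_char (P (k - 2) \<alpha> (of_int (z - w)) + (\<theta> * of_int (z - w) ^ k + \<gamma> * of_int z))) ^ (2 * b))
     = (\<Sum>(t, u)\<in>solutions b S (k - 2). e_char (\<Sum>i<b.
         (\<theta> * of_int (t i - w) ^ k + \<gamma> * of_int (t i)) - (\<theta> * of_int (u i - w) ^ k + \<gamma> * of_int (u i))))"
    by (rule mean_value_eq_sum_solutions[OF assms(1)])
  also have "\<dots> = restricted_sum b S k \<theta> (- (real k * \<theta> * of_int w))"
    unfolding restricted_sum_def
  proof (intro sum.cong refl, clarify)
    fix t u assume tu: "(t, u) \<in> solutions b S (k - 2)"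
    then have 0: "\<forall>j\<in>{1..k-2}. power_diff b j t u = 0" by (simp add: solutions_def)
    \<comment> \<open>This is where \<open>k \<ge> 3\<close> enters: degree 1 must be among the
      degrees up to \<open>k - 2\<close>.\<close>
    then have 1: "power_diff b 1 t u = 0" using assms(2) by auto
    have "(\<Sum>i<b. (\<theta> * of_int (t i - w) ^ k + \<gamma> * of_int (t i)) - (\<theta> * of_int (u i - w) ^ k + \<gamma> * of_int (u i)))
       = (\<Sum>i<b. \<theta> * of_int (t i - w) ^ k - \<theta> * of_int (u i - w) ^ k) + (\<Sum>i<b. \<gamma> * of_int (t i) ^ 1 - \<gamma> * of_int (u i) ^ 1)"
      by (simp add: sum.distrib sum_subtractf)
    also have "\<dots> = \<theta> * of_int (power_diff b k (\<lambda>i. t i - w) (\<lambda>i. u i - w))"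
      using sum_power_phase[of \<theta> "\<lambda>i. t i - w" k "\<lambda>i. u i - w" b] sum_power_phase[of \<gamma> t 1 u b] 1 by simp
    also have "\<dots> = \<theta> * of_int (power_diff b k t u) + - (real k * \<theta> * of_int w) * of_int (power_diff b (k - 1) t u)"
      using arg_cong[OF power_diff_shift_top[OF 0, of w], of real_of_int] assms(2)
      by (simp add: right_diff_distrib mult_ac)
    finally show "e_char (\<Sum>i<b. (\<theta> * of_int (t i - w) ^ k + \<gamma> * of_int (t i)) - (\<theta> * of_int (u i - w) ^ k + \<gamma> * of_int (u i))) =
       e_char (\<theta> * of_int (power_diff b k t u)) * e_char (- (real k * \<theta> * of_int w) * of_int (power_diff b (k - 1) t u))"
      by (simp only: e_char_add)
  qed
  finally have "of_real (LINT \<alpha>:unit_cube (k - 2)|lborel_pow (k - 2).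
      norm (\<Sum>z\<in>S. e_char (P (k - 2) \<alpha> (of_int (z - w)) + (\<theta> * of_int (z - w) ^ k + \<gamma> * of_int z))) ^ (2 * b))
     = complex_of_real (norm (restricted_sum b S k \<theta> (- (real k * \<theta> * of_int w))))"
    using restricted_sum_nonneg[OF assms(1)] by metis
  then show ?thesis by (simp only: of_real_eq_iff)
qed

lemma set_integrable_g_power:
  "set_integrable (lborel_pow (k - 2)) (unit_cube (k - 2)) (\<lambda>\<alpha>. norm (g k \<alpha> \<theta> X) ^ (2 * b))"
  using set_integrable_mean_value[of "{-\<lfloor>X\<rfloor>..\<lfloor>X\<rfloor>}" "k - 2" 0 "\<lambda>x. \<theta> * of_int x ^ k" b]
  by (simp add: g_def)

text \<open>Completion followed by Jensen bounds the integrand by twisted complete sums. Their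
  moments are all the same, so the weights sum up to one further factor \<open>L\<close>.\<close>

lemma integral_g_power_le:
  fixes N :: nat
  assumes "k \<ge> 3" "b \<ge> 1" "X \<ge> 1" "\<lfloor>X\<rfloor> < w" "w + \<lfloor>X\<rfloor> \<le> int N"
  shows "(LINT \<alpha>:unit_cube (k - 2)|lborel_pow (k - 2). norm (g k \<alpha> \<theta> X) ^ (2 * b))
    \<le> (2 + ln (real N)) ^ (2 * b) * norm (restricted_sum b {1..int N} k \<theta> (- (real k * \<theta> * of_int w)))"
proof -
  let ?n = "\<lfloor>X\<rfloor>"
  let ?F = "\<lambda>r \<alpha>. norm (\<Sum>z=1..int N. e_char (P (k - 2) \<alpha> (of_int (z - w)) +
      (\<theta> * of_int (z - w) ^ k + real r / real N * of_int z))) ^ (2 * b)"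
  let ?H = "norm (restricted_sum b {1..int N} k \<theta> (- (real k * \<theta> * of_int w)))"
  let ?I = "\<lambda>f. LINT \<alpha>:unit_cube (k - 2)|lborel_pow (k - 2). f \<alpha>"
  have n: "?n \<ge> 1" using assms by simp
  then have N: "N > 0" using assms by linarith
  define c where "c = completion_weight N (w - ?n) (w + ?n)"
  define L where "L = (\<Sum>r<N. c r)"
  have L: "0 \<le> L" "L \<le> 2 + ln (real N)"
    using sum_completion_weight_le[of "w - ?n" "w + ?n" N] assms n N
    by (auto simp: L_def c_def completion_weight_nonneg intro!: sum_nonneg)
  have pointwise: "norm (g k \<alpha> \<theta> X) ^ (2 * b) \<le> L ^ (2 * b - 1) * (\<Sum>r<N. c r * ?F r \<alpha>)" for \<alpha>
  proof -
    let ?a = "\<lambda>z. e_char (P (k - 2) \<alpha> (of_int (z - w)) + \<theta> * of_int (z - w) ^ k)"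
    \<comment> \<open>The window is centred at \<open>w\<close>; the assumptions on \<open>w\<close>
      place it inside \<open>{1..int N}\<close>.\<close>
    have "g k \<alpha> \<theta> X = (\<Sum>z=w-?n..w+?n. ?a z)"
      unfolding g_def
      by (rule sum.reindex_bij_witness[of _ "\<lambda>z. z - w" "\<lambda>x. x + w"]) auto
    then have "norm (g k \<alpha> \<theta> X) \<le> (\<Sum>r<N. c r * norm (\<Sum>z=1..int N. ?a z * e_char (real r / real N * of_int z)))"
      using norm_incomplete_sum_le[of "w - ?n" "w + ?n" N ?a] assms N by (simp add: c_def)
    also have "\<dots> = (\<Sum>r<N. c r * norm (\<Sum>z=1..int N. e_char (P (k - 2) \<alpha> (of_int (z - w)) +
      (\<theta> * of_int (z - w) ^ k + real r / real N * of_int z))))"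
      by (simp only: e_char_add mult.assoc)
    finally have "norm (g k \<alpha> \<theta> X) ^ (2 * b) \<le> \<dots> ^ (2 * b)"
      by (rule power_mono) simp
    also have "\<dots> \<le> L ^ (2 * b - 1) * (\<Sum>r<N. c r * ?F r \<alpha>)"
      unfolding L_def using assms
      by (intro power_weighted_sum_le) (auto simp: c_def completion_weight_nonneg)
    finally show ?thesis .
  qed
  have int: "set_integrable (lborel_pow (k - 2)) (unit_cube (k - 2)) (?F r)" for r
    by (rule set_integrable_mean_value) simp
  then have int': "integrable (lborel_pow (k - 2)) (\<lambda>\<alpha>. indicator (unit_cube (k - 2)) \<alpha> *\<^sub>R (c r * ?F r \<alpha>))" for r
    using set_integrable_mult_right[of "c r" _ _ "?F r"] unfolding set_integrable_def by blast
  then have intsum: "set_integrable (lborel_pow (k - 2)) (unit_cube (k - 2)) (\<lambda>\<alpha>. \<Sum>r<N. c r * ?F r \<alpha>)"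
    unfolding set_integrable_def scaleR_sum_right by (rule Bochner_Integration.integrable_sum)
  have "?I (\<lambda>\<alpha>. \<Sum>r<N. c r * ?F r \<alpha>) = (\<Sum>r<N. ?I (\<lambda>\<alpha>. c r * ?F r \<alpha>))"
    unfolding set_lebesgue_integral_def scaleR_sum_right by (rule Bochner_Integration.integral_sum) (rule int')
  then have sum_out: "?I (\<lambda>\<alpha>. \<Sum>r<N. c r * ?F r \<alpha>) = (\<Sum>r<N. c r * ?I (?F r))"
    by (simp only: set_integral_mult_right)
  have "?I (\<lambda>\<alpha>. norm (g k \<alpha> \<theta> X) ^ (2 * b)) \<le> ?I (\<lambda>\<alpha>. L ^ (2 * b - 1) * (\<Sum>r<N. c r * ?F r \<alpha>))"
    by (intro set_integral_mono set_integrable_g_power set_integrable_mult_right intsum pointwise)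
  also have "\<dots> = L ^ (2 * b - 1) * (\<Sum>r<N. c r * ?I (?F r))"
    by (simp only: set_integral_mult_right sum_out)
  \<comment> \<open>The moment does not depend on the linear twist, hence not on
    \<open>r\<close>.\<close>
  also have "\<dots> = L ^ (2 * b - 1) * (L * ?H)"
    by (simp only: mean_value_shift[OF finite_atLeastAtMost_int assms(1)] L_def sum_distrib_right)
  also have "\<dots> = L ^ (2 * b) * ?H"
  proof -
    have "L ^ (2 * b - 1) * L = L ^ (2 * b)" using assms(2) by (intro power_minus_mult) simp
    then show ?thesis by (simp only: mult.assoc[symmetric])
  qed
  also have "\<dots> \<le> (2 + ln (real N)) ^ (2 * b) * ?H"
    by (intro mult_right_mono power_mono L) auto
  finally show ?thesis .
qed

subsection \<open>Averaging against the Dirichlet kernel\<close>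

definition dirichlet_kernel :: "int \<Rightarrow> real \<Rightarrow> complex" where
  "dirichlet_kernel R t = (\<Sum>h=-R..R. e_char (t * of_int h))"

text \<open>Integration over \<open>\<nu>\<close> selects the kernel frequency
  \<open>h = s p\<close>, which is present in the kernel because
  \<open>\<bar>s p\<bar> \<le> R\<close>.\<close>

lemma trig_poly_reproduce:
  fixes f :: "real \<Rightarrow> complex" and s :: "'a \<Rightarrow> int"
  assumes f: "\<And>\<nu>. f \<nu> = (\<Sum>p\<in>V. c p * e_char (\<nu> * of_int (s p)))"
    and s: "\<And>p. p \<in> V \<Longrightarrow> \<bar>s p\<bar> \<le> R"
  shows "f \<mu> = (LINT \<nu>|lborel. indicator {0..1} \<nu> *\<^sub>R (f \<nu> * dirichlet_kernel R (\<mu> - \<nu>)))"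
proof -
  let ?e = "\<lambda>h \<nu>. indicator {0..1} \<nu> *\<^sub>R e_char (\<nu> * of_int h)"
  have e: "integrable lborel (?e h)" "integral\<^sup>L lborel (?e h) = of_bool (h = 0)" for h
    using integrable_e_char[of 0 h] integral_e_char[of 0 h] by simp_all
  have eq: "indicator {0..1} \<nu> *\<^sub>R (f \<nu> * dirichlet_kernel R (\<mu> - \<nu>)) =
      (\<Sum>p\<in>V. \<Sum>h=-R..R. c p * e_char (\<mu> * of_int h) * ?e (s p - h) \<nu>)" for \<nu>
  proof -
    have "c p * e_char (\<nu> * of_int (s p)) * e_char ((\<mu> - \<nu>) * of_int h) =
        c p * e_char (\<mu> * of_int h) * e_char (\<nu> * of_int (s p - h))" for p h
      by (simp add: e_char_add[symmetric] mult.assoc algebra_simps)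
    then have "f \<nu> * dirichlet_kernel R (\<mu> - \<nu>) =
       (\<Sum>p\<in>V. \<Sum>h=-R..R. c p * e_char (\<mu> * of_int h) * e_char (\<nu> * of_int (s p - h)))"
      by (simp only: f dirichlet_kernel_def sum_product)
    then show ?thesis by (simp add: scaleR_sum_right mult_scaleR_right del: of_int_diff)
  qed
  have "(LINT \<nu>|lborel. indicator {0..1} \<nu> *\<^sub>R (f \<nu> * dirichlet_kernel R (\<mu> - \<nu>))) =
      (\<Sum>p\<in>V. \<Sum>h=-R..R. c p * e_char (\<mu> * of_int h) * of_bool (s p - h = 0))"
    unfolding eq
    by (simp only: Bochner_Integration.integral_sum Bochner_Integration.integrable_sum
        integrable_mult_right integral_mult_right_zero e)
  also have "\<dots> = (\<Sum>p\<in>V. \<Sum>h=-R..R. if s p = h then c p * e_char (\<mu> * of_int h) else 0)"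
    by (intro sum.cong refl) auto
  also have "\<dots> = f \<mu>"
  proof -
    have "s p \<in> {-R..R}" if "p \<in> V" for p using s[OF that] by auto
    then show ?thesis by (auto simp: f intro!: sum.cong)
  qed
  finally show ?thesis by simp
qed

text \<open>Reproduction and the triangle inequality bound each value by an integral of
  \<open>norm f\<close> against a translated kernel. Summed over \<open>y\<close>, the kernels are
  at most \<open>B\<close>. Since \<open>f\<close> is nonnegative, the remaining integral of
  \<open>norm f\<close> is exactly the constant coefficient of \<open>f\<close>.\<close>

lemma sum_trig_poly_le:
  fixes f :: "real \<Rightarrow> complex" and s :: "'a \<Rightarrow> int"
  assumes f: "\<And>\<nu>. f \<nu> = (\<Sum>p\<in>V. c p * e_char (\<nu> * of_int (s p)))"
    and s: "\<And>p. p \<in> V \<Longrightarrow> \<bar>s p\<bar> \<le> R" and "finite V"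
    and nonneg: "\<And>\<nu>. f \<nu> = of_real (norm (f \<nu>))"
    and B: "\<And>\<nu>. (\<Sum>y\<in>Y. norm (dirichlet_kernel R (\<mu> y - \<nu>))) \<le> B"
  shows "(\<Sum>y\<in>Y. norm (f (\<mu> y))) \<le> B * norm (\<Sum>p | p \<in> V \<and> s p = 0. c p)"
proof -
  have cont: "continuous_on A f" for A
    unfolding f by (intro continuous_intros)
  have contD: "continuous_on A (\<lambda>\<nu>. dirichlet_kernel R (\<mu> - \<nu>))" for A \<mu>
    unfolding dirichlet_kernel_def by (intro continuous_intros)
  have intD: "integrable lborel (\<lambda>\<nu>. indicator {0..1::real} \<nu> *\<^sub>R (norm (f \<nu>) * norm (dirichlet_kernel R (\<mu> - \<nu>))))" for \<mu>
    by (intro borel_integrable_compact continuous_intros cont contD) auto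
  have intf: "integrable lborel (\<lambda>\<nu>. indicator {0..1::real} \<nu> *\<^sub>R norm (f \<nu>))"
    by (intro borel_integrable_compact continuous_intros cont) auto
  have "(\<Sum>y\<in>Y. norm (f (\<mu> y))) \<le>
      (\<Sum>y\<in>Y. LINT \<nu>|lborel. indicator {0..1} \<nu> *\<^sub>R (norm (f \<nu>) * norm (dirichlet_kernel R (\<mu> y - \<nu>))))"
  proof (intro sum_mono)
    fix y
    have "norm (f (\<mu> y)) \<le> (LINT \<nu>|lborel. norm (indicator {0..1} \<nu> *\<^sub>R (f \<nu> * dirichlet_kernel R (\<mu> y - \<nu>))))"
      by (subst trig_poly_reproduce[OF f s]) (simp, rule integral_norm_bound)
    also have "\<dots> = (LINT \<nu>|lborel. indicator {0..1} \<nu> *\<^sub>R (norm (f \<nu>) * norm (dirichlet_kernel R (\<mu> y - \<nu>))))"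
      by (intro Bochner_Integration.integral_cong refl) (auto simp: norm_mult)
    finally show "norm (f (\<mu> y)) \<le> \<dots>" .
  qed
  also have "\<dots> = (LINT \<nu>|lborel. (\<Sum>y\<in>Y. indicator {0..1} \<nu> *\<^sub>R (norm (f \<nu>) * norm (dirichlet_kernel R (\<mu> y - \<nu>)))))"
    by (intro Bochner_Integration.integral_sum[symmetric] intD)
  also have "\<dots> \<le> (LINT \<nu>|lborel. B * (indicator {0..1} \<nu> *\<^sub>R norm (f \<nu>)))"
  proof (intro integral_mono Bochner_Integration.integrable_sum intD integrable_mult_right intf)
    fix \<nu> :: real
    have "norm (f \<nu>) * (\<Sum>y\<in>Y. norm (dirichlet_kernel R (\<mu> y - \<nu>))) \<le> norm (f \<nu>) * B"
      by (intro mult_left_mono B) simp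
    then show "(\<Sum>y\<in>Y. indicator {0..1} \<nu> *\<^sub>R (norm (f \<nu>) * norm (dirichlet_kernel R (\<mu> y - \<nu>))))
        \<le> B * (indicator {0..1} \<nu> *\<^sub>R norm (f \<nu>))"
      by (auto simp: indicator_def sum_distrib_left mult.commute)
  qed
  also have "\<dots> = B * (LINT \<nu>|lborel. indicator {0..1} \<nu> *\<^sub>R norm (f \<nu>))"
    by (rule integral_mult_right_zero)
  also have "(LINT \<nu>|lborel. indicator {0..1} \<nu> *\<^sub>R norm (f \<nu>)) = norm (\<Sum>p | p \<in> V \<and> s p = 0. c p)"
  proof -
    have e: "integrable lborel (\<lambda>\<nu>. indicator {0..1} \<nu> *\<^sub>R e_char (\<nu> * of_int h))"
      "(LINT \<nu>|lborel. indicator {0..1} \<nu> *\<^sub>R e_char (\<nu> * of_int h)) = of_bool (h = 0)" for h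
      using integrable_e_char[of 0 h] integral_e_char[of 0 h] by simp_all
    have "complex_of_real (LINT \<nu>|lborel. indicator {0..1} \<nu> *\<^sub>R norm (f \<nu>)) =
        (LINT \<nu>|lborel. complex_of_real (indicator {0..1} \<nu> *\<^sub>R norm (f \<nu>)))"
      by (rule integral_complex_of_real[symmetric])
    also have "\<dots> = (LINT \<nu>|lborel. (\<Sum>p\<in>V. c p * (indicator {0..1} \<nu> *\<^sub>R e_char (\<nu> * of_int (s p)))))"
    proof (intro Bochner_Integration.integral_cong refl)
      fix \<nu> :: real
      have "complex_of_real (indicator {0..1} \<nu> *\<^sub>R norm (f \<nu>)) = indicator {0..1} \<nu> *\<^sub>R f \<nu>"
        using nonneg[of \<nu>] by (simp add: scaleR_conv_of_real)
      then show "complex_of_real (indicator {0..1} \<nu> *\<^sub>R norm (f \<nu>)) =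
          (\<Sum>p\<in>V. c p * (indicator {0..1} \<nu> *\<^sub>R e_char (\<nu> * of_int (s p))))"
        by (simp only: f scaleR_sum_right mult_scaleR_right)
    qed
    also have "\<dots> = (\<Sum>p\<in>V. c p * of_bool (s p = 0))"
      by (simp only: Bochner_Integration.integral_sum integrable_mult_right integral_mult_right_zero e)
    also have "\<dots> = (\<Sum>p | p \<in> V \<and> s p = 0. c p)"
      using \<open>finite V\<close> by (intro sum.mono_neutral_cong_right) auto
    finally have eq: "complex_of_real (LINT \<nu>|lborel. indicator {0..1} \<nu> *\<^sub>R norm (f \<nu>)) = (\<Sum>p | p \<in> V \<and> s p = 0. c p)" .
    have "(LINT \<nu>|lborel. indicator {0..1} \<nu> *\<^sub>R norm (f \<nu>)) \<ge> 0"
      by (rule Bochner_Integration.integral_nonneg) simp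
    then show ?thesis
      using arg_cong[OF eq, of norm] by simp
  qed
  finally show ?thesis .
qed

text \<open>The trivial bound \<open>2 * R + 1\<close> gives one branch of the minimum and the
  geometric sum estimate the other. The distance is taken at \<open>- t\<close> to match the sign of
  the phase in \<open>psi\<close>.\<close>

lemma norm_dirichlet_kernel_le:
  assumes "R \<ge> 0" "of_int (2 * R + 1) \<le> K * M" "K \<ge> 1"
  shows "norm (dirichlet_kernel R t) \<le> K * min_recip M (dist_int (- t))"
proof -
  let ?d = "dist_int (- t)" and ?D = "norm (dirichlet_kernel R t)"
  have "dirichlet_kernel R t = cnj (dirichlet_kernel R (- t))"
    by (simp add: dirichlet_kernel_def e_char_minus)
  then have "?D = norm (dirichlet_kernel R (- t))" by simp
  then have "?D * ?d \<le> 1 / 2"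
    using norm_sum_e_char_mult_le[of "- R" R "- t"] assms(1) by (simp add: dirichlet_kernel_def)
  moreover have "?D \<le> K * M"
  proof -
    have "?D \<le> real (card {- R..R})"
      unfolding dirichlet_kernel_def by (rule norm_sum_e_char_le_card)
    also have "\<dots> = of_int (2 * R + 1)" using assms(1) by simp
    finally show ?thesis using assms(2) by linarith
  qed
  moreover have "?D \<le> K * (1 / ?d)" if "?d \<noteq> 0"
  proof -
    have "?d > 0" using that dist_int_nonneg[of "- t"] by simp
    then have "?D \<le> 1 / ?d" using \<open>?D * ?d \<le> 1 / 2\<close> by (simp add: field_simps)
    also have "\<dots> \<le> K * (1 / ?d)" using assms(3) \<open>?d > 0\<close> by (simp add: divide_right_mono)
    finally show ?thesis .
  qed
  ultimately show ?thesis
    by (auto simp: min_recip_def min_def)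
qed

section \<open>The supremum of \<open>psi\<close> and the average over shifts\<close>

lemma min_recip_le: "min_recip M d \<le> M"
  by (simp add: min_recip_def)

lemma min_recip_nonneg: "M \<ge> 0 \<Longrightarrow> d \<ge> 0 \<Longrightarrow> min_recip M d \<ge> 0"
  by (simp add: min_recip_def)

lemma psi_le_psi_star:
  assumes "X \<ge> 1" shows "psi k \<theta> \<mu> X \<le> psi_star k \<theta> X"
  unfolding psi_star_def
proof (rule cSUP_upper)
  show "bdd_above (range (\<lambda>\<mu>. psi k \<theta> \<mu> X))"
  proof (rule bdd_aboveI2)
    show "psi k \<theta> \<mu> X \<le> 1 / X * (\<Sum>y::int\<in>{1..\<lfloor>X\<rfloor>}. X ^ (k - 1))" for \<mu>
      unfolding psi_def using assms by (intro mult_left_mono sum_mono min_recip_le) auto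
  qed
qed simp

lemma psi_star_nonneg:
  assumes "X \<ge> 1" shows "psi_star k \<theta> X \<ge> 0"
proof -
  have "0 \<le> psi k \<theta> 0 X"
    unfolding psi_def using assms
    by (intro mult_nonneg_nonneg sum_nonneg min_recip_nonneg dist_int_nonneg) auto
  then show ?thesis using psi_le_psi_star[OF assms] order.trans by blast
qed

text \<open>For \<open>k \<ge> 2\<close> this is the mean of \<open>restricted_sum\<close> over a
  period in \<open>\<mu>\<close>: that integration adds the equation of degree \<open>k - 1\<close>
  to the system.\<close>

definition top_sum :: "nat \<Rightarrow> int set \<Rightarrow> nat \<Rightarrow> real \<Rightarrow> complex" where
  "top_sum b S k \<theta> = (\<Sum>(t, u)\<in>solutions b S (k - 1). e_char (\<theta> * of_int (power_diff b k t u)))"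

lemma top_sum_nonneg:
  assumes "finite S"
  shows "top_sum b S k \<theta> = of_real (norm (top_sum b S k \<theta>))"
proof -
  have "top_sum b S k \<theta> = of_real (LINT \<alpha>:unit_cube (k - 1)|lborel_pow (k - 1).
      norm (\<Sum>z\<in>S. e_char (P (k - 1) \<alpha> (of_int (z - 0)) + \<theta> * of_int z ^ k)) ^ (2 * b))"
    using mean_value_eq_sum_solutions[OF assms, of "k - 1" 0 "\<lambda>z. \<theta> * of_int z ^ k" b]
    by (simp add: top_sum_def sum_power_phase)
  moreover have "(LINT \<alpha>:unit_cube (k - 1)|lborel_pow (k - 1).
      norm (\<Sum>z\<in>S. e_char (P (k - 1) \<alpha> (of_int (z - 0)) + \<theta> * of_int z ^ k)) ^ (2 * b)) \<ge> 0"
    unfolding set_lebesgue_integral_def by (rule Bochner_Integration.integral_nonneg) simp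
  ultimately show ?thesis by simp
qed

text \<open>Entries are positive, so each difference of powers is at most \<open>int N ^ j\<close>
  in absolute value. For \<open>j = k - 1\<close> this bounds the degree of
  \<open>restricted_sum\<close> as a trigonometric polynomial in \<open>\<mu>\<close>.\<close>

lemma abs_power_diff_le:
  assumes "t \<in> {..<b} \<rightarrow>\<^sub>E {1..int N}" "u \<in> {..<b} \<rightarrow>\<^sub>E {1..int N}"
  shows "\<bar>power_diff b j t u\<bar> \<le> int b * int N ^ j"
proof -
  have "\<bar>power_diff b j t u\<bar> \<le> (\<Sum>i<b. \<bar>t i ^ j - u i ^ j\<bar>)"
    unfolding power_diff_def by (rule sum_abs)
  also have "\<dots> \<le> (\<Sum>i<b. int N ^ j)"
  proof (intro sum_mono)
    fix i assume "i \<in> {..<b}"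
    then have "t i \<in> {1..int N}" "u i \<in> {1..int N}"
      using PiE_mem[OF assms(1)] PiE_mem[OF assms(2)] by blast+
    then have "0 \<le> t i ^ j" "t i ^ j \<le> int N ^ j" "0 \<le> u i ^ j" "u i ^ j \<le> int N ^ j"
      using power_mono[of "t i" "int N" j] power_mono[of "u i" "int N" j] by simp_all
    then show "\<bar>t i ^ j - u i ^ j\<bar> \<le> int N ^ j" by linarith
  qed
  finally show ?thesis by simp
qed

lemma sum_restricted_sum_le:
  assumes "k \<ge> 2" "b \<ge> 1" "X \<ge> 1" and N: "N \<ge> 1" "real N \<le> 5 * X"
  shows "(\<Sum>y=1..\<lfloor>X\<rfloor>. norm (restricted_sum b {1..int N} k \<theta> (- (real k * \<theta> * of_int (y + m)))))
    \<le> 3 * real b * 5 ^ (k - 1) * (X * psi_star k \<theta> X) * norm (top_sum b {1..int N} k \<theta>)"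
proof -
  let ?S = "{1..int N}"
  let ?V = "solutions b ?S (k - 2)"
  let ?c = "\<lambda>(t, u). e_char (\<theta> * of_int (power_diff b k t u))"
  let ?s = "\<lambda>(t, u). power_diff b (k - 1) t u"
  define R where "R = int b * int N ^ (k - 1)"
  define K where "K = 3 * real b * 5 ^ (k - 1)"
  have "(\<Sum>y=1..\<lfloor>X\<rfloor>. norm (restricted_sum b ?S k \<theta> (- (real k * \<theta> * of_int (y + m)))))
    \<le> (K * (X * psi_star k \<theta> X)) * norm (\<Sum>p | p \<in> ?V \<and> ?s p = 0. ?c p)"
  proof (rule sum_trig_poly_le[where R = R])
    show "restricted_sum b ?S k \<theta> \<nu> = (\<Sum>p\<in>?V. ?c p * e_char (\<nu> * of_int (?s p)))" for \<nu>
      by (simp add: restricted_sum_def case_prod_unfold)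
    show "\<bar>?s p\<bar> \<le> R" if "p \<in> ?V" for p
      using that abs_power_diff_le by (auto simp: solutions_def R_def)
    show "finite ?V" by (rule finite_solutions) simp
    show "restricted_sum b ?S k \<theta> \<nu> = of_real (norm (restricted_sum b ?S k \<theta> \<nu>))" for \<nu>
      by (rule restricted_sum_nonneg) simp
    fix \<nu>
    \<comment> \<open>The offset \<open>m\<close> and the integration variable \<open>\<nu>\<close>
      are absorbed into the shift of \<open>psi\<close>; this is why the supremum over that shift
      appears.\<close>
    let ?\<mu> = "real k * \<theta> * of_int m + \<nu>"
    \<comment> \<open>The constant \<open>K\<close> arises from \<open>2 * R + 1 \<le> 3 * R\<close>
      and \<open>real N \<le> 5 * X\<close>.\<close>
    have R: "of_int (2 * R + 1) \<le> K * X ^ (k - 1)"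
    proof -
      have "real b * real N ^ (k - 1) \<ge> 1"
        using assms(2) N by (metis mult_mono' mult_1 of_nat_1 of_nat_le_iff one_le_power zero_le_one)
      then have "of_int (2 * R + 1) \<le> 3 * real b * real N ^ (k - 1)"
        by (simp add: R_def)
      also have "\<dots> \<le> 3 * real b * (5 * X) ^ (k - 1)"
        using N by (intro mult_left_mono power_mono) auto
      finally show ?thesis by (simp add: K_def power_mult_distrib)
    qed
    have K: "K \<ge> 1"
    proof -
      have "1 * 1 \<le> (3 * real b) * 5 ^ (k - 1)"
        using assms(2) by (intro mult_mono one_le_power) auto
      then show ?thesis by (simp add: K_def)
    qed
    have "(\<Sum>y=1..\<lfloor>X\<rfloor>. norm (dirichlet_kernel R (- (real k * \<theta> * of_int (y + m)) - \<nu>)))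
      \<le> (\<Sum>y=1..\<lfloor>X\<rfloor>. K * min_recip (X ^ (k - 1)) (dist_int (- (- (real k * \<theta> * of_int (y + m)) - \<nu>))))"
      using R K by (intro sum_mono norm_dirichlet_kernel_le) (auto simp: R_def)
    also have "\<dots> = K * (\<Sum>y=1..\<lfloor>X\<rfloor>. min_recip (X ^ (k - 1)) (dist_int (real k * \<theta> * of_int y + ?\<mu>)))"
      by (simp add: sum_distrib_left algebra_simps)
    also have "\<dots> = K * (X * psi k \<theta> ?\<mu> X)"
      using assms(3) by (simp add: psi_def)
    also have "\<dots> \<le> K * (X * psi_star k \<theta> X)"
      using K assms(3) by (intro mult_left_mono psi_le_psi_star) auto
    finally show "(\<Sum>y=1..\<lfloor>X\<rfloor>. norm (dirichlet_kernel R (- (real k * \<theta> * of_int (y + m)) - \<nu>)))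
      \<le> K * (X * psi_star k \<theta> X)" .
  qed
  also have "{p. p \<in> ?V \<and> ?s p = 0} = solutions b ?S (k - 1)"
  proof -
    have "{1..k - 1} = insert (k - 1) {1..k - 2}" using assms(1) by auto
    then show ?thesis by (auto simp: solutions_def)
  qed
  finally show ?thesis by (simp add: K_def top_sum_def)
qed

text \<open>The bound for a single shift holds for every \<open>w = y + \<lfloor>X\<rfloor>\<close>
  with \<open>1 \<le> y \<le> \<lfloor>X\<rfloor>\<close>, so it may be averaged over
  \<open>y\<close>.\<close>

lemma integral_g_power_le_psi_star:
  assumes "k \<ge> 3" "b \<ge> 1" "X \<ge> 1"
  shows "(LINT \<alpha>:unit_cube (k - 2)|lborel_pow (k - 2). norm (g k \<alpha> \<theta> X) ^ (2 * b))
    \<le> 6 * real b * 5 ^ (k - 1) * 4 ^ (2 * b) * ln (4 * X) ^ (2 * b) * psi_star k \<theta> X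
        * norm (top_sum b {1..\<lfloor>4 * X + 1\<rfloor>} k \<theta>)"
proof -
  define N where "N = nat \<lfloor>4 * X + 1\<rfloor>"
  have N: "int N = \<lfloor>4 * X + 1\<rfloor>" using assms(3) by (simp add: N_def)
  \<comment> \<open>\<open>N3\<close> keeps the windows of all these shifts inside
    \<open>{1..int N}\<close>, since
    \<open>w + \<lfloor>X\<rfloor> \<le> 3 * \<lfloor>X\<rfloor>\<close>.\<close>
  then have N5: "real N \<le> 5 * X" and N1: "N \<ge> 1" and N3: "3 * \<lfloor>X\<rfloor> \<le> int N"
    using assms(3) by linarith+
  let ?n = "\<lfloor>X\<rfloor>" and ?I = "LINT \<alpha>:unit_cube (k - 2)|lborel_pow (k - 2). norm (g k \<alpha> \<theta> X) ^ (2 * b)"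
  let ?L = "4 * ln (4 * X)" and ?T = "psi_star k \<theta> X * norm (top_sum b {1..int N} k \<theta>)"
  let ?K = "3 * real b * 5 ^ (k - 1)"
  have L: "2 + ln (real N) \<le> ?L"
  proof -
    \<comment> \<open>Thus 2 is at most \<open>2 * ln (4 * X)\<close>; the other half of
      \<open>?L\<close> pays for \<open>ln (real N)\<close>.\<close>
    have "exp 1 \<le> 4 * X" using exp_le assms(3) by linarith
    then have 1: "1 \<le> ln (4 * X)" using assms(3) by (simp add: ln_ge_iff)
    have "real N \<le> (4 * X) ^ 2"
    proof -
      have "5 * X \<le> 16 * X * X" using assms(3) by simp
      then show ?thesis using N5 by (simp add: power2_eq_square)
    qed
    then have "ln (real N) \<le> ln ((4 * X) ^ 2)" using N1 by (intro ln_mono) auto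
    also have "\<dots> = 2 * ln (4 * X)" by (subst ln_realpow) (use assms(3) in simp_all)
    finally show ?thesis using 1 by simp
  qed
  have "of_int ?n * ?I = (\<Sum>y=1..?n. ?I)" using assms(3) by simp
  also have "\<dots> \<le> (\<Sum>y=1..?n. ?L ^ (2 * b) * norm (restricted_sum b {1..int N} k \<theta> (- (real k * \<theta> * of_int (y + ?n)))))"
  proof (intro sum_mono)
    fix y assume "y \<in> {1..?n}"
    then have "?I \<le> (2 + ln (real N)) ^ (2 * b) * norm (restricted_sum b {1..int N} k \<theta> (- (real k * \<theta> * of_int (y + ?n))))"
      using assms N3 by (intro integral_g_power_le) auto
    also have "\<dots> \<le> ?L ^ (2 * b) * norm (restricted_sum b {1..int N} k \<theta> (- (real k * \<theta> * of_int (y + ?n))))"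
      using L N1 by (intro mult_right_mono power_mono) auto
    finally show "?I \<le> \<dots>" .
  qed
  also have "\<dots> \<le> ?L ^ (2 * b) * (?K * (X * psi_star k \<theta> X) * norm (top_sum b {1..int N} k \<theta>))"
    unfolding sum_distrib_left[symmetric] using assms N1 N5
    by (intro mult_left_mono sum_restricted_sum_le) auto
  also have "\<dots> = X * (?L ^ (2 * b) * ?K * ?T)" by (simp add: mult_ac)
  \<comment> \<open>Replacing \<open>X\<close> by twice its floor allows division by the number of
    shifts and doubles the constant from 3 to 6.\<close>
  also have "\<dots> \<le> (2 * of_int ?n) * (?L ^ (2 * b) * ?K * ?T)"
  proof (intro mult_right_mono mult_nonneg_nonneg psi_star_nonneg assms)
    have "1 \<le> real_of_int ?n" using assms(3) by simp
    then show "X \<le> 2 * of_int ?n" using real_of_int_floor_add_one_gt[of X] by linarith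
  qed (simp_all add: zero_le_even_power)
  finally have "of_int ?n * ?I \<le> of_int ?n * (2 * (?L ^ (2 * b) * ?K * ?T))" by (simp add: mult_ac)
  then have "?I \<le> 2 * (?L ^ (2 * b) * ?K * ?T)"
    using assms(3) by (subst (asm) mult_le_cancel_left_pos) auto
  then show ?thesis by (simp add: N power_mult_distrib mult_ac)
qed

section \<open>Solution counts and the integral over \<open>\<theta>\<close>\<close>

lemma J_eq_card: "J b k Y = card (solutions b {1..\<lfloor>Y\<rfloor>} k)"
proof -
  have "complex_of_real (J b k Y) = of_real (real (card (solutions b {1..\<lfloor>Y\<rfloor>} k)))"
    using mean_value_eq_sum_solutions[of "{1..\<lfloor>Y\<rfloor>}" k 0 "\<lambda>_. 0" b]
    by (simp add: J_def case_prod_unfold)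
  then show ?thesis by (simp only: of_real_eq_iff)
qed

text \<open>Nonnegativity of \<open>top_sum\<close> removes the norm, and orthogonality over one
  period in \<open>\<theta>\<close> adds the last equation, of degree \<open>k\<close>.\<close>

lemma
  assumes "finite S" "k \<ge> 1"
  shows integrable_norm_top_sum: "integrable lborel (\<lambda>\<theta>. indicator {c..c + 1} \<theta> *\<^sub>R norm (top_sum b S k \<theta>))"
    and integral_norm_top_sum:
      "(LINT \<theta>|lborel. indicator {c..c + 1} \<theta> *\<^sub>R norm (top_sum b S k \<theta>)) = card (solutions b S k)"
proof -
  have cont: "continuous_on A (top_sum b S k)" for A
    unfolding top_sum_def case_prod_unfold by (intro continuous_intros)
  show "integrable lborel (\<lambda>\<theta>. indicator {c..c + 1} \<theta> *\<^sub>R norm (top_sum b S k \<theta>))"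
    by (intro borel_integrable_compact continuous_intros cont) auto
  let ?V = "solutions b S (k - 1)"
  have "complex_of_real (LINT \<theta>|lborel. indicator {c..c + 1} \<theta> *\<^sub>R norm (top_sum b S k \<theta>)) =
      (LINT \<theta>|lborel. complex_of_real (indicator {c..c + 1} \<theta> *\<^sub>R norm (top_sum b S k \<theta>)))"
    by (rule integral_complex_of_real[symmetric])
  also have "\<dots> = (LINT \<theta>|lborel. (\<Sum>(t, u)\<in>?V. indicator {c..c + 1} \<theta> *\<^sub>R e_char (\<theta> * of_int (power_diff b k t u))))"
  proof (intro Bochner_Integration.integral_cong refl)
    fix \<theta> :: real
    have "complex_of_real (indicator {c..c + 1} \<theta> *\<^sub>R norm (top_sum b S k \<theta>)) = indicator {c..c + 1} \<theta> *\<^sub>R top_sum b S k \<theta>"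
      using top_sum_nonneg[OF assms(1), of b k \<theta>] by (simp add: scaleR_conv_of_real)
    then show "complex_of_real (indicator {c..c + 1} \<theta> *\<^sub>R norm (top_sum b S k \<theta>)) =
        (\<Sum>(t, u)\<in>?V. indicator {c..c + 1} \<theta> *\<^sub>R e_char (\<theta> * of_int (power_diff b k t u)))"
      by (simp only: top_sum_def scaleR_sum_right case_prod_unfold)
  qed
  also have "\<dots> = (\<Sum>(t, u)\<in>?V. of_bool (power_diff b k t u = 0))"
    by (simp only: case_prod_unfold Bochner_Integration.integral_sum integrable_e_char integral_e_char)
  also have "\<dots> = (\<Sum>(t, u)\<in>solutions b S k. 1)"
  proof -
    have "{1..k} = insert k {1..k - 1}" using assms(2) by auto
    then show ?thesis
      by (intro sum.mono_neutral_cong_right finite_solutions assms(1)) (auto simp: solutions_def)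
  qed
  also have "\<dots> = of_real (real (card (solutions b S k)))"
    by (simp add: case_prod_unfold)
  finally show "(LINT \<theta>|lborel. indicator {c..c + 1} \<theta> *\<^sub>R norm (top_sum b S k \<theta>)) = card (solutions b S k)"
    by (simp only: of_real_eq_iff)
qed

text \<open>Used for Tonelli: \<open>A\<close> is merely Lebesgue measurable, so
  \<open>\<theta>\<close> is integrated against the completed measure.\<close>

lemma sigma_finite_lebesgue: "sigma_finite_measure (lebesgue :: real measure)"
proof
  let ?A = "range (\<lambda>n. {- real n..real n})"
  have "\<exists>n. x \<in> {- real n..real n}" for x
    using real_arch_simple[of "\<bar>x\<bar>"] by (auto simp: abs_le_iff minus_le_iff)
  then have "\<Union> ?A = space lebesgue" by auto
  moreover have "\<forall>a\<in>?A. emeasure lebesgue a \<noteq> \<infinity>" by simp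
  moreover have "countable ?A" "?A \<subseteq> sets lebesgue" by auto
  ultimately show "\<exists>A::real set set. countable A \<and> A \<subseteq> sets lebesgue \<and> \<Union> A = space lebesgue \<and>
      (\<forall>a\<in>A. emeasure lebesgue a \<noteq> \<infinity>)"
    by blast
qed

theorem theorem4:
  fixes k b :: nat
  assumes "k \<ge> 3" and "b \<ge> 1"
  shows "\<exists>C::real. C > 0 \<and>
    (\<forall>(X::real) (c::real) (A::real set).
       X \<ge> 1 \<longrightarrow> A \<in> sets lebesgue \<longrightarrow> A \<subseteq> {c..c + 1} \<longrightarrow>
         (\<integral>\<^sup>+ (\<alpha>, \<theta>) \<in> unit_cube (k - 2) \<times> A.
             ennreal (norm (g k \<alpha> \<theta> X) ^ (2 * b)) \<partial>(lborel_pow (k - 2) \<Otimes>\<^sub>M lebesgue))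
         \<le> ennreal (C * ln (4 * X) ^ (2 * b))
            * (SUP \<theta>\<in>A. ennreal (psi_star k \<theta> X))
            * ennreal (J b k (4 * X + 1)))"
proof (intro exI[of _ "6 * real b * 5 ^ (k - 1) * 4 ^ (2 * b)"] conjI allI impI)
  let ?C = "6 * real b * 5 ^ (k - 1) * 4 ^ (2 * b)"
  show "?C > 0" using assms by simp
  fix X c :: real and A :: "real set"
  assume X: "X \<ge> 1" and A: "A \<in> sets lebesgue" "A \<subseteq> {c..c + 1}"
  let ?M = "lborel_pow (k - 2)" and ?U = "unit_cube (k - 2)"
  let ?S = "{1..\<lfloor>4 * X + 1\<rfloor>}"
  let ?\<Psi> = "SUP \<theta>\<in>A. ennreal (psi_star k \<theta> X)" and ?c = "?C * ln (4 * X) ^ (2 * b)"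
  let ?G = "\<lambda>\<alpha> \<theta>. norm (g k \<alpha> \<theta> X) ^ (2 * b)" and ?T = "\<lambda>\<theta>. norm (top_sum b ?S k \<theta>)"
  interpret L: sigma_finite_measure "lebesgue :: real measure" by (rule sigma_finite_lebesgue)
  interpret product_sigma_finite "\<lambda>_. lborel :: real measure" by unfold_locales
  interpret M: sigma_finite_measure ?M by (rule sigma_finite) simp
  interpret pair_sigma_finite ?M "lebesgue :: real measure" by unfold_locales
  have [measurable]: "?U \<in> sets ?M" by (intro sets_PiM_I_finite) auto
  note A(1)[measurable]
  \<comment> \<open>The second coordinate carries the Lebesgue sigma-algebra, which is finer than
    the Borel one in which \<open>g\<close> is continuous.\<close>
  have [measurable]: "(\<lambda>z. snd z) \<in> borel_measurable (?M \<Otimes>\<^sub>M (lebesgue :: real measure))"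
    by (rule measurable_compose[OF measurable_snd]) (simp add: measurable_completion)
  have [measurable]: "(\<lambda>z. fst z i) \<in> borel_measurable (?M \<Otimes>\<^sub>M (lebesgue :: real measure))" if "i \<in> {1..k - 2}" for i
    using that by simp
  have meas: "(\<lambda>(\<alpha>, \<theta>). ennreal (?G \<alpha> \<theta>) * indicator (?U \<times> A) (\<alpha>, \<theta>)) \<in> borel_measurable (?M \<Otimes>\<^sub>M lebesgue)"
    unfolding g_def P_def case_prod_unfold by measurable
  have c: "?c \<ge> 0" using X by simp
  have inner: "(\<integral>\<^sup>+ \<alpha>. ennreal (?G \<alpha> \<theta>) * indicator (?U \<times> A) (\<alpha>, \<theta>) \<partial>?M) \<le>
      ennreal ?c * ?\<Psi> * ennreal (indicator {c..c + 1} \<theta> *\<^sub>R ?T \<theta>)" for \<theta>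
  proof (cases "\<theta> \<in> A")
    case True
    have "(\<integral>\<^sup>+ \<alpha>. ennreal (?G \<alpha> \<theta>) * indicator (?U \<times> A) (\<alpha>, \<theta>) \<partial>?M) =
        (\<integral>\<^sup>+ \<alpha>. ennreal (indicator ?U \<alpha> *\<^sub>R ?G \<alpha> \<theta>) \<partial>?M)"
      using True by (intro nn_integral_cong) (auto simp: indicator_def)
    also have "\<dots> = ennreal (LINT \<alpha>:?U|?M. ?G \<alpha> \<theta>)"
      using set_integrable_g_power[of k \<theta> X b] unfolding set_integrable_def set_lebesgue_integral_def
      by (intro nn_integral_eq_integral) auto
    also have "\<dots> \<le> ennreal (?c * psi_star k \<theta> X * ?T \<theta>)"
      by (intro ennreal_leI integral_g_power_le_psi_star assms X)
    also have "\<dots> = ennreal ?c * ennreal (psi_star k \<theta> X) * ennreal (?T \<theta>)"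
      using c psi_star_nonneg[OF X] by (simp only: ennreal_mult mult_nonneg_nonneg norm_ge_zero)
    also have "\<dots> \<le> ennreal ?c * ?\<Psi> * ennreal (?T \<theta>)"
      using True by (intro mult_right_mono mult_left_mono SUP_upper) auto
    \<comment> \<open>With \<open>\<psi>\<close> bounded by its supremum, the nonnegative rest can
      be integrated over the whole period \<open>{c..c + 1}\<close> instead of
      \<open>A\<close>.\<close>
    also have "?T \<theta> = indicator {c..c + 1} \<theta> *\<^sub>R ?T \<theta>"
      using True A(2) by (auto simp: indicator_def)
    finally show ?thesis .
  qed simp
  have "(\<integral>\<^sup>+ (\<alpha>, \<theta>) \<in> ?U \<times> A. ennreal (?G \<alpha> \<theta>) \<partial>(?M \<Otimes>\<^sub>M lebesgue)) =
      (\<integral>\<^sup>+ \<theta>. (\<integral>\<^sup>+ \<alpha>. ennreal (?G \<alpha> \<theta>) * indicator (?U \<times> A) (\<alpha>, \<theta>) \<partial>?M) \<partial>lebesgue)"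
    using nn_integral_snd[OF meas] by (simp add: case_prod_unfold)
  also have "\<dots> \<le> (\<integral>\<^sup>+ \<theta>. ennreal ?c * ?\<Psi> * ennreal (indicator {c..c + 1} \<theta> *\<^sub>R ?T \<theta>) \<partial>lebesgue)"
    by (intro nn_integral_mono inner)
  \<comment> \<open>Completing the measure does not change a nonnegative integral, and the solution
    count is expressed by an integral over \<open>lborel\<close>.\<close>
  also have "\<dots> = (\<integral>\<^sup>+ \<theta>. ennreal ?c * ?\<Psi> * ennreal (indicator {c..c + 1} \<theta> *\<^sub>R ?T \<theta>) \<partial>lborel)"
    by (rule nn_integral_completion)
  also have "\<dots> = ennreal ?c * ?\<Psi> * (\<integral>\<^sup>+ \<theta>. ennreal (indicator {c..c + 1} \<theta> *\<^sub>R ?T \<theta>) \<partial>lborel)"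
    using integrable_norm_top_sum[of ?S k c b] assms by (intro nn_integral_cmult) auto
  also have "(\<integral>\<^sup>+ \<theta>. ennreal (indicator {c..c + 1} \<theta> *\<^sub>R ?T \<theta>) \<partial>lborel) = ennreal (J b k (4 * X + 1))"
    using integrable_norm_top_sum[of ?S k c b] integral_norm_top_sum[of ?S k c b] assms
    by (subst nn_integral_eq_integral) (auto simp: J_eq_card)
  finally show "(\<integral>\<^sup>+ (\<alpha>, \<theta>) \<in> ?U \<times> A. ennreal (?G \<alpha> \<theta>) \<partial>(?M \<Otimes>\<^sub>M lebesgue))
      \<le> ennreal ?c * ?\<Psi> * ennreal (J b k (4 * X + 1))" .
qed

end
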